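(* For every $(t, w(\cdot)) \in G$ and every $\theta \in [t, T]$, the value functional $\rho: G \to \mathbb{R}$ satisfies $$\rho(t, w(\cdot)) = \inf_{u(\cdot) \in \mathcal{U}(t, \theta)} \Big( \rho(\theta, x(\cdot)) + \int_t^\theta \chi(\tau, x(\tau), u(\tau)) \, d\tau \Big),$$ where, for each $u(\cdot) \in \mathcal{U}(t,\theta)$, $x(\cdot) = x(\cdot \mid t, w(\cdot), \theta, u(\cdot))$ is the motion of the system ${}^C D^\alpha x(\tau) = f(\tau, x(\tau), u(\tau))$ on $[0,\theta]$ generated from the position $(t, w(\cdot))$ by the control $u(\cdot)$.
   Context: Fix $T>0$, $n \in \mathbb{N}$, $\alpha \in (0,1)$. $\|\cdot\|$ and $\langle\cdot,\cdot\rangle$ are the Euclidean norm and inner product in $\mathbb{R}^n$. Function spaces. For $t\in[0,T]$, $L^\infty([0,t],\mathbb{R}^n)$ is the set of measurable $\psi:[0,t]\to\mathbb{R}^n$ with $\|\psi(\cdot)\|_{[0,t]}<\infty$, where $\|\psi(\cdot)\|_{[0,t]}=\operatorname{ess\,sup}_{\tau\in[0,t]}\|\psi(\tau)\|$ if $t>0$ and $\|\psi(0)\|$ if $t=0$. For $\beta\in(0,1)$, $(I^\beta\psi)(\tau)=\frac{1}{\Gamma(\beta)}\int_0^\tau \frac{\psi(\xi)}{(\tau-\xi)^{1-\beta}}d\xi$. $AC^\alpha([0,t],\mathbb{R}^n)$ is the set of functions $x:[0,t]\to\mathbb{R}^n$ of the form $x(\tau)=x(0)+(I^\alpha\psi)(\tau)$,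 $\tau\in[0,t]$, for some $\psi(\cdot)\in L^\infty([0,t],\mathbb{R}^n)$ (for $t=0$ it is identified with $\mathbb{R}^n$). For such $x(\cdot)$ the Caputo derivative $({}^CD^\alpha x)(\tau)=\frac{d}{d\tau}\big(I^{1-\alpha}(x(\cdot)-x(0))\big)(\tau)$ exists for a.e. $\tau\in[0,t]$ and equals $\psi(\tau)$ a.e. Positions. $G$ is the set of pairs $(t,w(\cdot))$ with $t\in[0,T]$ and $w(\cdot)\in AC^\alpha([0,t],\mathbb{R}^n)$. Data. $P\subset\mathbb{R}^{n_u}$ is a nonempty compact set. $f:[0,T]\times\mathbb{R}^n\times P\to\mathbb{R}^n$ is continuous; for every $R>0$ there is $\lambda_f>0$ with $\|f(\tau,x,u)-f(\tau,x',u)\|\le\lambda_f\|x-x'\|$ for all $\tau\in[0,T]$, $\|x\|,\|x'\|\le R$, $u\in P$; and there is $c_f>0$ with $\|f(\tau,x,u)\|\le(1+\|x\|)c_f$ for all $(\tau,x,u)$. $\sigma:\mathbb{R}^n\to\mathbb{R}$ and $\chi:[0,T]\times\mathbb{R}^n\times P\to\mathbb{R}$ are continuous. Motions. For $0\le t\le\theta\le T$, $\mathcal{U}(t,\theta)$ is the set of measurable functions $u:[t,\theta]\to P$. For $(t,w(\cdot))\in G$, $\theta\in[t,T]$, $u(\cdot)\in\mathcal{U}(t,\theta)$, the motion $x(\cdot)=x(\cdot\mid t,w(\cdot),\theta,u(\cdot))$ is the unique $x(\cdot)\in AC^\alpha([0,\theta],\mathbb{R}^n)$ with $x(\tau)=w(\tau)$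 for $\tau\in[0,t]$ and $({}^CD^\alpha x)(\tau)=f(\tau,x(\tau),u(\tau))$ for a.e. $\tau\in[t,\theta]$ (it exists and is unique because $f$ is continuous and, in its second argument, locally Lipschitz continuous and of sublinear growth). Equivalently, it is the unique continuous function on $[0,\theta]$ equal to $w$ on $[0,t]$ and satisfying, for $\tau\in[t,\theta]$, $x(\tau)=w(0)+\frac{1}{\Gamma(\alpha)}\int_0^t\frac{({}^CD^\alpha w)(\xi)}{(\tau-\xi)^{1-\alpha}}d\xi+\frac{1}{\Gamma(\alpha)}\int_t^\tau\frac{f(\xi,x(\xi),u(\xi))}{(\tau-\xi)^{1-\alpha}}d\xi$. Value functional. For $(t,w(\cdot))\in G$ and $u(\cdot)\in\mathcal{U}(t,T)$, $J(t,w(\cdot),u(\cdot))=\sigma(x(T))+\int_t^T\chi(\tau,x(\tau),u(\tau))\,d\tau$ with $x(\cdot)=x(\cdot\mid t,w(\cdot),T,u(\cdot))$, and $\rho(t,w(\cdot))=\inf_{u(\cdot)\in\mathcal{U}(t,T)}J(t,w(\cdot),u(\cdot))$. *)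

theory Defs
  imports "HOL-Analysis.Analysis" "HOL-Probability.Essential_Supremum"
begin

text \<open>
  Functions on \<open>[0,t]\<close> or \<open>[t,\<theta>]\<close> are extensional: total functions on the reals that take
  the value \<^const>\<open>undefined\<close> outside the interval, so that equality of such functions is
  equality on the interval. Measurable means Lebesgue measurable.
\<close>

definition Linf_norm :: "real \<Rightarrow> (real \<Rightarrow> 'a::euclidean_space) \<Rightarrow> ereal" where
  "Linf_norm t \<psi> =
     (if t > 0 then esssup (lebesgue_on {0..t}) (\<lambda>\<tau>. ereal (norm (\<psi> \<tau>)))
      else ereal (norm (\<psi> 0)))"

definition Linf :: "real \<Rightarrow> (real \<Rightarrow> 'a::euclidean_space) set" where
  "Linf t = {\<psi> \<in> extensional {0..t}.
     \<psi> \<in> borel_measurable (lebesgue_on {0..t}) \<and> Linf_norm t \<psi> < \<infinity>}"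

text \<open>
  At \<open>\<xi> = \<tau>\<close> the integrand is \<open>0\<close> by the convention \<open>1 / 0 = 0\<close>.
\<close>

definition frac_int :: "real \<Rightarrow> (real \<Rightarrow> 'a::euclidean_space) \<Rightarrow> real \<Rightarrow> 'a" where
  "frac_int \<beta> \<psi> \<tau> =
     (1 / Gamma \<beta>) *\<^sub>R (LINT \<xi>:{0..\<tau>}|lebesgue. (1 / (\<tau> - \<xi>) powr (1 - \<beta>)) *\<^sub>R \<psi> \<xi>)"

definition AC_frac :: "real \<Rightarrow> real \<Rightarrow> (real \<Rightarrow> 'a::euclidean_space) set" where
  "AC_frac \<alpha> t = {x \<in> extensional {0..t}.
     \<exists>\<psi>\<in>Linf t. \<forall>\<tau>\<in>{0..t}. x \<tau> = x 0 + frac_int \<alpha> \<psi> \<tau>}"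

text \<open>
  The Caputo derivative of order \<open>\<alpha>\<close> of a function \<open>x\<close> on \<open>[0,t]\<close> exists at \<open>\<tau>\<close> and equals \<open>d\<close>.
\<close>

definition has_caputo_derivative ::
    "real \<Rightarrow> real \<Rightarrow> (real \<Rightarrow> 'a::euclidean_space) \<Rightarrow> 'a \<Rightarrow> real \<Rightarrow> bool" where
  "has_caputo_derivative \<alpha> t x d \<tau> \<longleftrightarrow>
     (frac_int (1 - \<alpha>) (\<lambda>\<xi>. x \<xi> - x 0) has_vector_derivative d) (at \<tau> within {0..t})"

definition positions :: "real \<Rightarrow> real \<Rightarrow> (real \<times> (real \<Rightarrow> 'a::euclidean_space)) set" where
  "positions \<alpha> T = (SIGMA t:{0..T}. AC_frac \<alpha> t)"

definition controls :: "'b::euclidean_space set \<Rightarrow> real \<Rightarrow> real \<Rightarrow> (real \<Rightarrow> 'b) set" where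
  "controls P t \<theta> = {u \<in> {t..\<theta>} \<rightarrow>\<^sub>E P. u \<in> borel_measurable (lebesgue_on {t..\<theta>})}"

definition motion ::
    "real \<Rightarrow> (real \<Rightarrow> 'a::euclidean_space \<Rightarrow> 'b::euclidean_space \<Rightarrow> 'a) \<Rightarrow>
     real \<Rightarrow> (real \<Rightarrow> 'a) \<Rightarrow> real \<Rightarrow> (real \<Rightarrow> 'b) \<Rightarrow> (real \<Rightarrow> 'a)" where
  "motion \<alpha> f t w \<theta> u = (THE x. x \<in> AC_frac \<alpha> \<theta> \<and>
     (\<forall>\<tau>\<in>{0..t}. x \<tau> = w \<tau>) \<and>
     (AE \<tau> in lebesgue_on {t..\<theta>}. has_caputo_derivative \<alpha> \<theta> x (f \<tau> (x \<tau>) (u \<tau>)) \<tau>))"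

definition cost ::
    "real \<Rightarrow> real \<Rightarrow> (real \<Rightarrow> 'a::euclidean_space \<Rightarrow> 'b::euclidean_space \<Rightarrow> 'a) \<Rightarrow>
     ('a \<Rightarrow> real) \<Rightarrow> (real \<Rightarrow> 'a \<Rightarrow> 'b \<Rightarrow> real) \<Rightarrow>
     real \<Rightarrow> (real \<Rightarrow> 'a) \<Rightarrow> (real \<Rightarrow> 'b) \<Rightarrow> real" where
  "cost \<alpha> T f \<sigma> chi t w u =
     (let x = motion \<alpha> f t w T u
      in \<sigma> (x T) + (LINT \<tau>:{t..T}|lebesgue. chi \<tau> (x \<tau>) (u \<tau>)))"

definition value_functional ::
    "real \<Rightarrow> real \<Rightarrow> 'b::euclidean_space set \<Rightarrow>
     (real \<Rightarrow> 'a::euclidean_space \<Rightarrow> 'b \<Rightarrow> 'a) \<Rightarrow>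
     ('a \<Rightarrow> real) \<Rightarrow> (real \<Rightarrow> 'a \<Rightarrow> 'b \<Rightarrow> real) \<Rightarrow>
     real \<Rightarrow> (real \<Rightarrow> 'a) \<Rightarrow> real" where
  "value_functional \<alpha> T P f \<sigma> chi t w = (INF u\<in>controls P t T. cost \<alpha> T f \<sigma> chi t w u)"

end

theory Submission
  imports Defs
begin

text \<open>
  A control on \<open>[t, T]\<close> is a control on \<open>[t, \<theta>]\<close> followed by one on \<open>[\<theta>, T]\<close>, and the motion it
  generates is, up to \<open>\<theta>\<close>, the motion generated by the first piece and, from the position reached at \<open>\<theta>\<close>,
  the motion generated by the second. This follows from the definition once motions exist and are unique, and
  the cost splits accordingly; taking infima in two steps gives the result. Since infima of reals are meaningful
  only for sets bounded below, motions also have to be bounded uniformly in the control.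

  Existence, uniqueness and the bound come from the equivalent Volterra equation
  \<open>x = w 0 + I\<^sup>\<alpha> (rhs (\<cdot>, x))\<close>. It is equivalent because \<open>I\<^sup>1\<^sup>-\<^sup>\<alpha> I\<^sup>\<alpha> = I\<^sup>1\<close> (Fubini and the Beta
  integral), so that the Caputo derivative of \<open>x 0 + I\<^sup>\<alpha> \<psi>\<close> is \<open>\<psi>\<close> almost everywhere by Lebesgue's
  differentiation theorem. For it, the weighted norm \<open>sup exp (- l \<tau>) \<bar>x \<tau>\<bar>\<close> replaces a singular
  Gronwall inequality, because \<open>I\<^sup>\<alpha> (exp (l \<cdot>)) \<le> exp (l \<cdot>) / l\<^sup>\<alpha>\<close>.
\<close>

section \<open>The fractional integral\<close>

text \<open>The base point of the Caputo derivative stays at 0, however late the motion starts. This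
  is why a position has to carry a whole history, and also why cutting and continuing a motion costs
  nothing: the function that is differentiated, \<open>I^(1-\<alpha>) (x - x 0)\<close>, depends at
  each time \<open>s\<close> only on \<open>x\<close> before \<open>s\<close>, and a derivative
  within an interval is also one within a subinterval.

  The analytic difficulty lies elsewhere. A density in \<open>Linf\<close> is only Lebesgue
  measurable and essentially bounded, whereas Fubini on the product of two copies of
  \<open>lborel\<close> asks for Borel functions and the estimates ask for bounds at every point.
  Since the fractional integral ignores null sets, each such density is exchanged for a Borel one
  that is bounded everywhere.

  \<open>motion\<close> is a definite description, so nothing can be said about it before existence
  and uniqueness are available; the work is therefore done on a predicate and on an integral
  equation over all of \<open>[0, \<theta>]\<close>, with the history absorbed into the right-hand
  side.\<close>

lemma has_integral_frac_kernel:
  fixes \<beta> \<tau> a b :: real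
  assumes "0 < \<beta>" "a \<le> b" "b \<le> \<tau>"
  shows "((\<lambda>\<xi>. 1 / (\<tau> - \<xi>) powr (1 - \<beta>)) has_integral
           ((\<tau> - a) powr \<beta> - (\<tau> - b) powr \<beta>) / \<beta>) {a..b}"
proof -
  have "((\<lambda>\<xi>. 1 / (\<tau> - \<xi>) powr (1 - \<beta>)) has_integral
         (- ((\<tau> - b) powr \<beta>) / \<beta> - (- ((\<tau> - a) powr \<beta>) / \<beta>))) {a..b}"
  \<comment> \<open>The derivative is asked for only in the open interval: for
    \<open>b = \<tau>\<close> and \<open>\<beta> < 1\<close> the kernel blows up at the right
    endpoint, where the antiderivative is merely continuous.\<close>
  proof (rule fundamental_theorem_of_calculus_interior[OF assms(2)])
    show "continuous_on {a..b} (\<lambda>\<xi>. - ((\<tau> - \<xi>) powr \<beta>) / \<beta>)"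
      using assms by (intro continuous_intros continuous_on_powr') auto
    fix x assume x: "x \<in> {a<..<b}"
    have "((\<lambda>\<xi>. - ((\<tau> - \<xi>) powr \<beta>) / \<beta>) has_real_derivative (\<tau> - x) powr (\<beta> - 1)) (at x)"
      using assms x by (auto intro!: derivative_eq_intros simp: field_simps)
    moreover have "(\<tau> - x) powr (\<beta> - 1) = 1 / (\<tau> - x) powr (1 - \<beta>)"
      by (metis minus_diff_eq powr_minus_divide)
    ultimately show "((\<lambda>\<xi>. - ((\<tau> - \<xi>) powr \<beta>) / \<beta>) has_vector_derivative 1 / (\<tau> - x) powr (1 - \<beta>)) (at x)"
      by (simp add: has_real_derivative_iff_has_vector_derivative)
  qed
  then show ?thesis by (simp add: diff_divide_distrib)
qed

text \<open>The majorant \<open>C\<close> times the kernel is integrable. The upper limit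
  \<open>b\<close> may lie below \<open>\<tau>\<close> because the Hoelder estimate integrates the
  kernel of a later time over an earlier interval.\<close>

lemma absolutely_integrable_frac_kernel:
  fixes \<psi> :: "real \<Rightarrow> 'a::euclidean_space"
  assumes "0 < \<beta>" "b \<le> \<tau>" and m: "\<psi> \<in> borel_measurable lebesgue"
    and bd: "\<And>\<xi>. norm (\<psi> \<xi>) \<le> C"
  shows "(\<lambda>\<xi>. (1 / (\<tau> - \<xi>) powr (1 - \<beta>)) *\<^sub>R \<psi> \<xi>) absolutely_integrable_on {a..b}"
proof (cases "a \<le> b")
  case True
  have i: "(\<lambda>\<xi>. C * (1 / (\<tau> - \<xi>) powr (1 - \<beta>))) integrable_on {a..b}"
    using has_integral_mult_right[OF has_integral_frac_kernel[OF assms(1) True assms(2)], of C] by blast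
  have [measurable]: "\<psi> \<in> borel_measurable (lebesgue_on {a..b})"
    using m by (rule measurable_restrict_space1)
  have "(\<lambda>\<xi>. 1 / (\<tau> - \<xi>) powr (1 - \<beta>)) \<in> borel_measurable borel"
    by measurable
  then have [measurable]: "(\<lambda>\<xi>. 1 / (\<tau> - \<xi>) powr (1 - \<beta>)) \<in> borel_measurable (lebesgue_on {a..b})"
    by (intro measurable_restrict_space1 measurable_completion) simp
  have mm: "(\<lambda>\<xi>. (1 / (\<tau> - \<xi>) powr (1 - \<beta>)) *\<^sub>R \<psi> \<xi>) \<in> borel_measurable (lebesgue_on {a..b})"
    by measurable
  show ?thesis
  proof (rule measurable_bounded_by_integrable_imp_absolutely_integrable[OF mm _ i])
    fix x
    show "norm ((1 / (\<tau> - x) powr (1 - \<beta>)) *\<^sub>R \<psi> x) \<le> C * (1 / (\<tau> - x) powr (1 - \<beta>))"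
      using bd[of x] by (simp add: divide_right_mono)
  qed simp
qed simp

lemma frac_int_eq_integral:
  fixes \<psi> :: "real \<Rightarrow> 'a::euclidean_space"
  assumes "0 < \<beta>" "\<psi> \<in> borel_measurable lebesgue" "\<And>\<xi>. norm (\<psi> \<xi>) \<le> C"
  shows "frac_int \<beta> \<psi> \<tau> =
    (1 / Gamma \<beta>) *\<^sub>R integral {0..\<tau>} (\<lambda>\<xi>. (1 / (\<tau> - \<xi>) powr (1 - \<beta>)) *\<^sub>R \<psi> \<xi>)"
  unfolding frac_int_def
  by (subst set_lebesgue_integral_eq_integral(2)[OF absolutely_integrable_frac_kernel[OF assms(1) order_refl assms(2,3)]]) simp

text \<open>
  The kernel vanishes at the endpoint because \<open>1 / 0 = 0\<close>, so the value of \<open>\<psi>\<close> there is irrelevant.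
\<close>

lemma frac_int_cong:
  assumes "\<And>\<xi>. \<lbrakk>0 \<le> \<xi>; \<xi> < \<tau>\<rbrakk> \<Longrightarrow> \<psi> \<xi> = \<phi> \<xi>"
  shows "frac_int \<beta> \<psi> \<tau> = frac_int \<beta> \<phi> \<tau>"
proof -
  have "(1 / (\<tau> - \<xi>) powr (1 - \<beta>)) *\<^sub>R \<psi> \<xi> = (1 / (\<tau> - \<xi>) powr (1 - \<beta>)) *\<^sub>R \<phi> \<xi>"
    if "\<xi> \<in> {0..\<tau>}" for \<xi>
    using assms[of \<xi>] that by (cases "\<xi> = \<tau>") auto
  then have "(LINT \<xi>:{0..\<tau>}|lebesgue. (1 / (\<tau> - \<xi>) powr (1 - \<beta>)) *\<^sub>R \<psi> \<xi>) =
        (LINT \<xi>:{0..\<tau>}|lebesgue. (1 / (\<tau> - \<xi>) powr (1 - \<beta>)) *\<^sub>R \<phi> \<xi>)"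
    by (intro set_lebesgue_integral_cong) auto
  then show ?thesis
    unfolding frac_int_def by simp
qed

lemma frac_int_cong_AE:
  fixes \<psi> \<phi> :: "real \<Rightarrow> 'a::euclidean_space"
  assumes "AE \<xi> in lebesgue. 0 \<le> \<xi> \<longrightarrow> \<xi> < \<tau> \<longrightarrow> \<psi> \<xi> = \<phi> \<xi>"
    and "\<psi> \<in> borel_measurable lebesgue" "\<phi> \<in> borel_measurable lebesgue"
  shows "frac_int \<beta> \<psi> \<tau> = frac_int \<beta> \<phi> \<tau>"
proof -
  have k: "(\<lambda>\<xi>. 1 / (\<tau> - \<xi>) powr (1 - \<beta>)) \<in> borel_measurable lebesgue"
    by (intro measurable_completion) measurable
  note [measurable] = k assms(2,3)
  have "(LINT \<xi>:{0..\<tau>}|lebesgue. (1 / (\<tau> - \<xi>) powr (1 - \<beta>)) *\<^sub>R \<psi> \<xi>) =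
        (LINT \<xi>:{0..\<tau>}|lebesgue. (1 / (\<tau> - \<xi>) powr (1 - \<beta>)) *\<^sub>R \<phi> \<xi>)"
  proof (rule set_lebesgue_integral_cong_AE)
    show "AE \<xi>\<in>{0..\<tau>} in lebesgue. (1 / (\<tau> - \<xi>) powr (1 - \<beta>)) *\<^sub>R \<psi> \<xi> =
        (1 / (\<tau> - \<xi>) powr (1 - \<beta>)) *\<^sub>R \<phi> \<xi>"
      using assms(1)
    proof eventually_elim
      case (elim \<xi>)
      then show ?case by (cases "\<xi> = \<tau>") auto
    qed
  qed auto
  then show ?thesis by (simp add: frac_int_def)
qed

lemma norm_frac_int_le:
  fixes \<psi> :: "real \<Rightarrow> 'a::euclidean_space" and h :: "real \<Rightarrow> real"
  assumes "0 < \<beta>" and \<psi>: "\<psi> \<in> borel_measurable lebesgue" "\<And>\<xi>. norm (\<psi> \<xi>) \<le> C"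
    and h: "continuous_on {0..\<tau>} h"
    and le: "\<And>\<xi>. \<lbrakk>0 \<le> \<xi>; \<xi> < \<tau>\<rbrakk> \<Longrightarrow> norm (\<psi> \<xi>) \<le> h \<xi>"
  shows "norm (frac_int \<beta> \<psi> \<tau>) \<le>
    (1 / Gamma \<beta>) * integral {0..\<tau>} (\<lambda>\<xi>. (1 / (\<tau> - \<xi>) powr (1 - \<beta>)) * h \<xi>)"
proof -
  have "compact (h ` {0..\<tau>})" by (intro compact_continuous_image h) simp
  then have "bounded (h ` {0..\<tau>})" by (rule compact_imp_bounded)
  then obtain D where D: "\<And>\<xi>. \<xi> \<in> {0..\<tau>} \<Longrightarrow> \<bar>h \<xi>\<bar> \<le> D"
    unfolding bounded_real by blast
  \<comment> \<open>\<open>h\<close> is controlled on \<open>[0, \<tau>]\<close> only; the extension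
    by 0 is measurable and bounded on the whole line, as the integrability of kernel times density
    asks.\<close>
  define h' where "h' = (\<lambda>\<xi>. if \<xi> \<in> {0..\<tau>} then h \<xi> else 0)"
  have hm: "h' \<in> borel_measurable lebesgue"
    unfolding h'_def by (intro borel_measurable_if_I continuous_imp_measurable_on_sets_lebesgue h) auto
  have hb: "norm (h' \<xi>) \<le> \<bar>D\<bar>" for \<xi> using D[of \<xi>] by (auto simp: h'_def)
  have "(\<lambda>\<xi>. (1 / (\<tau> - \<xi>) powr (1 - \<beta>)) * h' \<xi>) absolutely_integrable_on {0..\<tau>}"
    using absolutely_integrable_frac_kernel[OF assms(1) order_refl hm hb] by simp
  then have "(\<lambda>\<xi>. (1 / (\<tau> - \<xi>) powr (1 - \<beta>)) * h' \<xi>) integrable_on {0..\<tau>}"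
    using absolutely_integrable_on_def by blast
  then have hi: "(\<lambda>\<xi>. (1 / (\<tau> - \<xi>) powr (1 - \<beta>)) * h \<xi>) integrable_on {0..\<tau>}"
    by (rule integrable_eq) (auto simp: h'_def)
  have "norm (integral {0..\<tau>} (\<lambda>\<xi>. (1 / (\<tau> - \<xi>) powr (1 - \<beta>)) *\<^sub>R \<psi> \<xi>)) \<le>
        integral {0..\<tau>} (\<lambda>\<xi>. (1 / (\<tau> - \<xi>) powr (1 - \<beta>)) * h \<xi>)"
  proof (rule Henstock_Kurzweil_Integration.integral_norm_bound_integral[OF _ hi])
    show "(\<lambda>\<xi>. (1 / (\<tau> - \<xi>) powr (1 - \<beta>)) *\<^sub>R \<psi> \<xi>) integrable_on {0..\<tau>}"
      using absolutely_integrable_frac_kernel[OF assms(1) order_refl \<psi>]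
      using absolutely_integrable_on_def by blast
    fix x assume "x \<in> {0..\<tau>}"
    then show "norm ((1 / (\<tau> - x) powr (1 - \<beta>)) *\<^sub>R \<psi> x) \<le> 1 / (\<tau> - x) powr (1 - \<beta>) * h x"
      using le[of x] by (cases "x = \<tau>") (auto intro: divide_right_mono)
  qed
  then show ?thesis
    using assms(1) by (simp add: frac_int_eq_integral[OF assms(1) \<psi>] divide_right_mono Gamma_real_pos less_imp_le)
qed

text \<open>The kernel decreases as its time grows, so on \<open>[0, s]\<close> the difference of
  the two kernels has a sign and integrates exactly to \<open>(s^\<beta> - \<tau>^\<beta> + (\<tau>
  - s)^\<beta>) / \<beta>\<close>, which is at most \<open>(\<tau> - s)^\<beta> / \<beta>\<close>.
  The remaining piece over \<open>[s, \<tau>]\<close> contributes the same amount; hence the factor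
  2.\<close>

lemma frac_int_holder:
  fixes \<psi> :: "real \<Rightarrow> 'a::euclidean_space"
  assumes \<beta>: "0 < \<beta>" "\<beta> < 1" and \<psi>: "\<psi> \<in> borel_measurable lebesgue" "\<And>\<xi>. norm (\<psi> \<xi>) \<le> C"
    and "0 \<le> s" "s \<le> \<tau>"
  shows "norm (frac_int \<beta> \<psi> \<tau> - frac_int \<beta> \<psi> s) \<le> 2 * C / (\<beta> * Gamma \<beta>) * (\<tau> - s) powr \<beta>"
proof -
  define k where "k = (\<lambda>\<tau> \<xi>::real. 1 / (\<tau> - \<xi>) powr (1 - \<beta>))"
  have kp: "k \<tau> \<xi> \<ge> 0" for \<tau> \<xi> by (simp add: k_def)
  have C: "C \<ge> 0" using \<psi>(2)[of 0] norm_ge_zero order_trans by blast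
  have ai: "(\<lambda>\<xi>. k \<tau> \<xi> *\<^sub>R \<psi> \<xi>) integrable_on {a..b}" if "b \<le> \<tau>" for a b \<tau>
    unfolding k_def using absolutely_integrable_frac_kernel[OF \<beta>(1) that \<psi>]
    using absolutely_integrable_on_def by blast
  have ki: "(k \<tau> has_integral ((\<tau> - a) powr \<beta> - (\<tau> - b) powr \<beta>) / \<beta>) {a..b}" if "a \<le> b" "b \<le> \<tau>" for \<tau> a b
    unfolding k_def by (rule has_integral_frac_kernel[OF \<beta>(1) that])
  have mono: "k \<tau> \<xi> \<le> k s \<xi>" if "\<xi> < s" for \<xi>
    unfolding k_def using \<beta> assms that by (intro divide_left_mono powr_mono2) auto
  have split: "integral {0..\<tau>} (\<lambda>\<xi>. k \<tau> \<xi> *\<^sub>R \<psi> \<xi>) - integral {0..s} (\<lambda>\<xi>. k s \<xi> *\<^sub>R \<psi> \<xi>)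
     = integral {0..s} (\<lambda>\<xi>. k \<tau> \<xi> *\<^sub>R \<psi> \<xi> - k s \<xi> *\<^sub>R \<psi> \<xi>) + integral {s..\<tau>} (\<lambda>\<xi>. k \<tau> \<xi> *\<^sub>R \<psi> \<xi>)"
  proof -
    have "integral {0..s} (\<lambda>\<xi>. k \<tau> \<xi> *\<^sub>R \<psi> \<xi> - k s \<xi> *\<^sub>R \<psi> \<xi>) =
        integral {0..s} (\<lambda>\<xi>. k \<tau> \<xi> *\<^sub>R \<psi> \<xi>) - integral {0..s} (\<lambda>\<xi>. k s \<xi> *\<^sub>R \<psi> \<xi>)"
      using assms by (intro Henstock_Kurzweil_Integration.integral_diff ai) auto
    then show ?thesis
      unfolding Henstock_Kurzweil_Integration.integral_combine[OF assms(5,6) ai[OF order_refl], symmetric]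
      by simp
  qed
  have b2: "norm (integral {s..\<tau>} (\<lambda>\<xi>. k \<tau> \<xi> *\<^sub>R \<psi> \<xi>)) \<le> C * ((\<tau> - s) powr \<beta> / \<beta>)"
  proof -
    have i: "((\<lambda>\<xi>. C * k \<tau> \<xi>) has_integral C * (((\<tau> - s) powr \<beta> - (\<tau> - \<tau>) powr \<beta>) / \<beta>)) {s..\<tau>}"
      by (intro has_integral_mult_right ki) (use assms in auto)
    have "norm (integral {s..\<tau>} (\<lambda>\<xi>. k \<tau> \<xi> *\<^sub>R \<psi> \<xi>)) \<le> integral {s..\<tau>} (\<lambda>\<xi>. C * k \<tau> \<xi>)"
      by (rule Henstock_Kurzweil_Integration.integral_norm_bound_integral[OF ai has_integral_integrable[OF i]])
         (use \<psi>(2) kp in \<open>auto simp: mult.commute[of C] mult_left_mono\<close>)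
    then show ?thesis unfolding integral_unique[OF i] by simp
  qed
  have b1: "norm (integral {0..s} (\<lambda>\<xi>. k \<tau> \<xi> *\<^sub>R \<psi> \<xi> - k s \<xi> *\<^sub>R \<psi> \<xi>)) \<le> C * ((\<tau> - s) powr \<beta> / \<beta>)"
  proof -
    have *: "((\<lambda>\<xi>. C * (k s \<xi> - k \<tau> \<xi>)) has_integral C * (((s - 0) powr \<beta> - (s - s) powr \<beta>) / \<beta>
        - ((\<tau> - 0) powr \<beta> - (\<tau> - s) powr \<beta>) / \<beta>)) {0..s}"
      by (intro has_integral_mult_right has_integral_diff ki) (use assms in auto)
    \<comment> \<open>At \<open>\<xi> = s\<close> the convention \<open>1 / 0 = 0\<close> makes
      \<open>k s s\<close> vanish, so \<open>k s - k \<tau>\<close> need not dominate there.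
      Changing the majorant at this one point leaves its integral alone.\<close>
    have **: "((\<lambda>\<xi>. if \<xi> = s then C * k \<tau> s else C * (k s \<xi> - k \<tau> \<xi>)) has_integral C * (((s - 0) powr \<beta> - (s - s) powr \<beta>) / \<beta>
        - ((\<tau> - 0) powr \<beta> - (\<tau> - s) powr \<beta>) / \<beta>)) {0..s}"
      by (rule has_integral_spike_finite[OF _ _ *, of "{s}"]) auto
    have "norm (integral {0..s} (\<lambda>\<xi>. k \<tau> \<xi> *\<^sub>R \<psi> \<xi> - k s \<xi> *\<^sub>R \<psi> \<xi>)) \<le>
       integral {0..s} (\<lambda>\<xi>. if \<xi> = s then C * k \<tau> s else C * (k s \<xi> - k \<tau> \<xi>))"
    proof (rule Henstock_Kurzweil_Integration.integral_norm_bound_integral)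
      show "(\<lambda>\<xi>. k \<tau> \<xi> *\<^sub>R \<psi> \<xi> - k s \<xi> *\<^sub>R \<psi> \<xi>) integrable_on {0..s}"
        using assms by (intro Henstock_Kurzweil_Integration.integrable_diff ai) auto
      fix \<xi> assume \<xi>: "\<xi> \<in> {0..s}"
      show "norm (k \<tau> \<xi> *\<^sub>R \<psi> \<xi> - k s \<xi> *\<^sub>R \<psi> \<xi>) \<le> (if \<xi> = s then C * k \<tau> s else C * (k s \<xi> - k \<tau> \<xi>))"
      proof (cases "\<xi> = s")
        case True
        then have "k s \<xi> = 0" by (simp add: k_def)
        then show ?thesis using True \<psi>(2)[of s] kp[of \<tau> s] by (simp add: mult.commute[of C] mult_left_mono)
      next
        case False
        then have "norm (k \<tau> \<xi> *\<^sub>R \<psi> \<xi> - k s \<xi> *\<^sub>R \<psi> \<xi>) = (k s \<xi> - k \<tau> \<xi>) * norm (\<psi> \<xi>)"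
          using mono[of \<xi>] \<xi> by (simp flip: scaleR_left_diff_distrib)
        also have "\<dots> \<le> (k s \<xi> - k \<tau> \<xi>) * C"
          using mono[of \<xi>] \<xi> False \<psi>(2) by (intro mult_left_mono) auto
        finally show ?thesis using False by (simp add: mult.commute)
      qed
    qed (use ** in blast)
    also have "\<dots> = C * ((s powr \<beta> - \<tau> powr \<beta> + (\<tau> - s) powr \<beta>) / \<beta>)"
      using integral_unique[OF **] by (simp add: diff_divide_distrib add_divide_distrib)
    also have "\<dots> \<le> C * ((\<tau> - s) powr \<beta> / \<beta>)"
      using C \<beta> assms by (intro mult_left_mono divide_right_mono) (auto intro: powr_mono2)
    finally show ?thesis .
  qed
  have "norm (integral {0..\<tau>} (\<lambda>\<xi>. k \<tau> \<xi> *\<^sub>R \<psi> \<xi>) - integral {0..s} (\<lambda>\<xi>. k s \<xi> *\<^sub>R \<psi> \<xi>))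
      \<le> C * ((\<tau> - s) powr \<beta> / \<beta>) + C * ((\<tau> - s) powr \<beta> / \<beta>)"
    unfolding split by (rule norm_triangle_mono[OF b1 b2])
  also have "\<dots> = 2 * C / \<beta> * (\<tau> - s) powr \<beta>" by simp
  finally have "norm (integral {0..\<tau>} (\<lambda>\<xi>. k \<tau> \<xi> *\<^sub>R \<psi> \<xi>) - integral {0..s} (\<lambda>\<xi>. k s \<xi> *\<^sub>R \<psi> \<xi>))
      \<le> 2 * C / \<beta> * (\<tau> - s) powr \<beta>" .
  moreover have "frac_int \<beta> \<psi> \<tau> - frac_int \<beta> \<psi> s =
     (1 / Gamma \<beta>) *\<^sub>R (integral {0..\<tau>} (\<lambda>\<xi>. k \<tau> \<xi> *\<^sub>R \<psi> \<xi>) - integral {0..s} (\<lambda>\<xi>. k s \<xi> *\<^sub>R \<psi> \<xi>))"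
    by (simp add: frac_int_eq_integral[OF \<beta>(1) \<psi>] k_def scaleR_diff_right)
  ultimately show ?thesis
    using Gamma_real_pos[OF \<beta>(1)] divide_right_mono[of _ "2 * C / \<beta> * (\<tau> - s) powr \<beta>" "Gamma \<beta>"] by simp
qed

lemma continuous_on_frac_int:
  fixes \<psi> :: "real \<Rightarrow> 'a::euclidean_space"
  assumes \<beta>: "0 < \<beta>" "\<beta> < 1" and \<psi>: "\<psi> \<in> borel_measurable lebesgue" "\<And>\<xi>. norm (\<psi> \<xi>) \<le> C"
  shows "continuous_on {0..t} (frac_int \<beta> \<psi>)"
proof (rule continuous_onI)
  fix x e :: real assume x: "x \<in> {0..t}" and e: "e > 0"
  define K where "K = 2 * C / (\<beta> * Gamma \<beta>)"
  have K: "norm (frac_int \<beta> \<psi> y - frac_int \<beta> \<psi> x) \<le> K * \<bar>y - x\<bar> powr \<beta>" if "y \<in> {0..t}" for y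
    using frac_int_holder[OF \<beta> \<psi>, where s=x and \<tau>=y] frac_int_holder[OF \<beta> \<psi>, where s=y and \<tau>=x] x that
    by (cases "x \<le> y") (auto simp: K_def norm_minus_commute)
  have "((\<lambda>y. K * \<bar>y - x\<bar> powr \<beta>) \<longlongrightarrow> K * \<bar>x - x\<bar> powr \<beta>) (at x within {0..t})"
    using \<beta> by (intro tendsto_intros tendsto_powr') auto
  then have "\<exists>d>0. \<forall>y\<in>{0..t}. 0 < dist y x \<and> dist y x < d \<longrightarrow> dist (K * \<bar>y - x\<bar> powr \<beta>) 0 < e"
    using e \<beta> by (simp add: Lim_within)
  then show "\<exists>d>0. \<forall>y\<in>{0..t}. dist y x < d \<longrightarrow> dist (frac_int \<beta> \<psi> y) (frac_int \<beta> \<psi> x) \<le> e"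
  proof (elim exE conjE, intro exI conjI ballI impI)
    fix d y assume d: "\<forall>y\<in>{0..t}. 0 < dist y x \<and> dist y x < d \<longrightarrow> dist (K * \<bar>y - x\<bar> powr \<beta>) 0 < e"
      and y: "y \<in> {0..t}" "dist y x < d"
    show "dist (frac_int \<beta> \<psi> y) (frac_int \<beta> \<psi> x) \<le> e"
    proof (cases "y = x")
      case False
      then have "K * \<bar>y - x\<bar> powr \<beta> < e" using d y by (auto simp: dist_norm)
      then show ?thesis using K[OF y(1)] by (simp add: dist_norm)
    qed (use e in simp)
  qed
qed

text \<open>The substitution \<open>r = l * (\<tau> - \<xi>)\<close> turns the left side into
  \<open>exp (l * \<tau>) / l^\<beta>\<close> times an incomplete Gamma integral over
  \<open>[0, l * \<tau>]\<close>, divided by \<open>Gamma \<beta>\<close>. The factor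
  \<open>l^(-\<beta>)\<close> is the gain: it becomes as small as desired for large
  \<open>l\<close>, whatever the length of the interval.\<close>

lemma integral_frac_kernel_exp_le:
  fixes \<tau> l \<beta> :: real
  assumes "0 < \<beta>" "0 < l" "0 \<le> \<tau>"
  shows "(1 / Gamma \<beta>) * integral {0..\<tau>} (\<lambda>\<xi>. (1 / (\<tau> - \<xi>) powr (1 - \<beta>)) * exp (l * \<xi>)) \<le> exp (l * \<tau>) / l powr \<beta>"
proof -
  let ?g = "\<lambda>t::real. t powr (\<beta> - 1) / exp t"
  have G: "(?g has_integral Gamma \<beta>) {0..}" by (rule Gamma_integral_real[OF assms(1)])
  then have ii: "?g integrable_on {0..l * \<tau>}"
    by (rule integrable_on_subinterval[OF has_integral_integrable]) auto
  define I where "I = integral {0..l * \<tau>} ?g"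
  have I: "(?g has_integral I) (cbox 0 (l * \<tau>))" using ii by (auto simp: I_def)
  have "I \<le> Gamma \<beta>"
    by (rule has_integral_subset_le[OF _ I G]) auto
  have "((\<lambda>\<xi>. ?g ((- l) *\<^sub>R \<xi> + l * \<tau>)) has_integral I / l) {0..\<tau>}"
  proof -
    have "(\<lambda>x. (1 / (- l)) *\<^sub>R x + - ((1 / (- l)) *\<^sub>R (l * \<tau>))) ` cbox 0 (l * \<tau>) = {0..\<tau>}"
      unfolding image_affinity_cbox using assms by (auto simp: not_le mult_less_0_iff)
    with has_integral_affinity[OF I, of "- l" "l * \<tau>"] assms show ?thesis by simp
  qed
  then have "((\<lambda>\<xi>. exp (l * \<tau>) * l powr (1 - \<beta>) * ?g ((- l) *\<^sub>R \<xi> + l * \<tau>)) has_integral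
       exp (l * \<tau>) * l powr (1 - \<beta>) * (I / l)) {0..\<tau>}"
    by (rule has_integral_mult_right)
  then have "((\<lambda>\<xi>. (1 / (\<tau> - \<xi>) powr (1 - \<beta>)) * exp (l * \<xi>)) has_integral
       exp (l * \<tau>) * l powr (1 - \<beta>) * (I / l)) {0..\<tau>}"
  proof (rule has_integral_eq[rotated])
    fix \<xi> assume \<xi>: "\<xi> \<in> {0..\<tau>}"
    have 1: "(- l) *\<^sub>R \<xi> + l * \<tau> = l * (\<tau> - \<xi>)" by (simp add: algebra_simps)
    \<comment> \<open>This includes \<open>\<xi> = \<tau>\<close>, where \<open>0 powr _ = 0\<close>
      agrees with \<open>1 / 0 = 0\<close>.\<close>
    have 2: "(l * (\<tau> - \<xi>)) powr (\<beta> - 1) = 1 / (l powr (1 - \<beta>) * (\<tau> - \<xi>) powr (1 - \<beta>))"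
      using assms \<xi> powr_minus_divide[of "l * (\<tau> - \<xi>)" "1 - \<beta>"] by (simp add: powr_mult)
    show "exp (l * \<tau>) * l powr (1 - \<beta>) * ?g ((- l) *\<^sub>R \<xi> + l * \<tau>) = (1 / (\<tau> - \<xi>) powr (1 - \<beta>)) * exp (l * \<xi>)"
      unfolding 1 2 using assms by (simp add: field_simps exp_diff)
  qed
  then have "(1 / Gamma \<beta>) * integral {0..\<tau>} (\<lambda>\<xi>. (1 / (\<tau> - \<xi>) powr (1 - \<beta>)) * exp (l * \<xi>))
      = (1 / Gamma \<beta>) * (exp (l * \<tau>) * l powr (1 - \<beta>) * (I / l))"
    by (simp add: integral_unique)
  also have "\<dots> \<le> (1 / Gamma \<beta>) * (exp (l * \<tau>) * l powr (1 - \<beta>) * (Gamma \<beta> / l))"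
    using \<open>I \<le> Gamma \<beta>\<close> assms Gamma_real_pos[OF assms(1)]
    by (intro mult_left_mono divide_right_mono) auto
  also have "\<dots> = exp (l * \<tau>) / l powr \<beta>"
    using assms Gamma_real_pos[OF assms(1), THEN less_imp_neq] by (simp add: powr_diff)
  finally show ?thesis .
qed

text \<open>The affine map \<open>r = m * s + c\<close> carries \<open>[\<xi>, \<tau>]\<close> to
  \<open>[0, 1]\<close> and the integrand to that of \<open>Beta \<alpha> (1 - \<alpha>)\<close>.
  The two exponents add up to -1, so the powers of \<open>\<tau> - \<xi>\<close> cancel against the
  Jacobian. That the value is independent of \<open>\<xi>\<close> and \<open>\<tau>\<close> is the
  reason why the two fractional integrals compose to the ordinary one.\<close>

lemma has_integral_Beta_kernel:
  fixes \<alpha> \<xi> \<tau> :: real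
  assumes "0 < \<alpha>" "\<alpha> < 1" "\<xi> < \<tau>"
  shows "((\<lambda>s. (1 / (\<tau> - s) powr \<alpha>) * (1 / (s - \<xi>) powr (1 - \<alpha>))) has_integral Gamma \<alpha> * Gamma (1 - \<alpha>)) {\<xi>..\<tau>}"
proof -
  let ?g = "\<lambda>t::real. t powr (\<alpha> - 1) * (1 - t) powr ((1 - \<alpha>) - 1)"
  have "(?g has_integral Beta \<alpha> (1 - \<alpha>)) (cbox 0 1)"
    using has_integral_Beta_real[of \<alpha> "1 - \<alpha>"] assms by simp
  moreover have "Beta \<alpha> (1 - \<alpha>) = Gamma \<alpha> * Gamma (1 - \<alpha>)"
    by (simp add: Beta_def)
  ultimately have g: "(?g has_integral Gamma \<alpha> * Gamma (1 - \<alpha>)) (cbox 0 1)" by simp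
  define m c where "m = 1 / (\<tau> - \<xi>)" and "c = - \<xi> / (\<tau> - \<xi>)"
  have m: "m > 0" "1 / m = \<tau> - \<xi>" using assms by (auto simp: m_def)
  have c: "- (1 / m * c) = \<xi>" using assms by (simp add: m_def c_def)
  have "((\<lambda>s. ?g (m *\<^sub>R s + c)) has_integral (1 / m) * (Gamma \<alpha> * Gamma (1 - \<alpha>))) {\<xi>..\<tau>}"
  proof -
    have "(\<lambda>x. (1 / m) *\<^sub>R x + - ((1 / m) *\<^sub>R c)) ` cbox 0 1 = {\<xi>..\<tau>}"
      unfolding image_affinity_cbox using assms by (simp add: m_def c_def)
    with has_integral_affinity[OF g, of m c] m(1) show ?thesis by simp
  qed
  then have "((\<lambda>s. m * ?g (m *\<^sub>R s + c)) has_integral m * ((1 / m) * (Gamma \<alpha> * Gamma (1 - \<alpha>)))) {\<xi>..\<tau>}"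
    by (rule has_integral_mult_right)
  moreover have "m * ((1 / m) * (Gamma \<alpha> * Gamma (1 - \<alpha>))) = Gamma \<alpha> * Gamma (1 - \<alpha>)"
    using m(1) by simp
  ultimately have "((\<lambda>s. m * ?g (m *\<^sub>R s + c)) has_integral Gamma \<alpha> * Gamma (1 - \<alpha>)) {\<xi>..\<tau>}"
    by (simp only:)
  then show ?thesis
  proof (rule has_integral_eq[rotated])
    fix s assume s: "s \<in> {\<xi>..\<tau>}"
    have 1: "m *\<^sub>R s + c = (s - \<xi>) / (\<tau> - \<xi>)" by (simp add: m_def c_def diff_divide_distrib)
    have 2: "1 - (s - \<xi>) / (\<tau> - \<xi>) = (\<tau> - s) / (\<tau> - \<xi>)" using assms by (simp add: field_simps)
    have 3: "((s - \<xi>) / (\<tau> - \<xi>)) powr (\<alpha> - 1) = (1 / (s - \<xi>) powr (1 - \<alpha>)) * (\<tau> - \<xi>) powr (1 - \<alpha>)"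
      using s assms powr_minus_divide[of "(s - \<xi>) / (\<tau> - \<xi>)" "1 - \<alpha>"] by (simp add: powr_divide)
    have 4: "((\<tau> - s) / (\<tau> - \<xi>)) powr (1 - \<alpha> - 1) = (1 / (\<tau> - s) powr \<alpha>) * (\<tau> - \<xi>) powr \<alpha>"
      using s assms powr_minus_divide[of "(\<tau> - s) / (\<tau> - \<xi>)" \<alpha>] by (simp add: powr_divide)
    have 5: "(\<tau> - \<xi>) powr (1 - \<alpha>) * (\<tau> - \<xi>) powr \<alpha> = \<tau> - \<xi>"
      using assms by (simp flip: powr_add)
    show "m * ?g (m *\<^sub>R s + c) = (1 / (\<tau> - s) powr \<alpha>) * (1 / (s - \<xi>) powr (1 - \<alpha>))"
    proof -
      have "m * ((1 / (s - \<xi>) powr (1 - \<alpha>)) * (\<tau> - \<xi>) powr (1 - \<alpha>) * ((1 / (\<tau> - s) powr \<alpha>) * (\<tau> - \<xi>) powr \<alpha>))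
        = m * ((\<tau> - \<xi>) powr (1 - \<alpha>) * (\<tau> - \<xi>) powr \<alpha>) * ((1 / (\<tau> - s) powr \<alpha>) * (1 / (s - \<xi>) powr (1 - \<alpha>)))"
        by (simp only: mult_ac)
      also have "\<dots> = (1 / (\<tau> - s) powr \<alpha>) * (1 / (s - \<xi>) powr (1 - \<alpha>))"
        unfolding 5 using assms by (simp add: m_def)
      finally show ?thesis unfolding 1 2 3 4 .
    qed
  qed
qed

section \<open>The Caputo derivative of a fractional integral\<close>

text \<open>\<open>integrable_ccontinuous_explicit\<close> controls only the averages over intervals
  to the right of \<open>x\<close>. The averages to the left are right averages of the reflected
  function \<open>\<phi> (- x)\<close> at \<open>- x\<close>; its exceptional set is reflected back
  and stays negligible.\<close>

lemma has_vector_derivative_indefinite_integral_AE: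
  fixes \<phi> :: "real \<Rightarrow> 'a::euclidean_space"
  assumes int: "\<And>a b. \<phi> integrable_on {a..b}"
  shows "AE x in lebesgue. x \<in> {a..b} \<longrightarrow>
    ((\<lambda>\<tau>. integral {a..\<tau>} \<phi>) has_vector_derivative \<phi> x) (at x within {a..b})"
proof -
  obtain N1 where N1: "negligible N1"
    "\<And>x e. \<lbrakk>x \<notin> N1; 0 < e\<rbrakk> \<Longrightarrow> \<exists>d>0. \<forall>h. 0 < h \<and> h < d \<longrightarrow>
       norm (integral (cbox x (x + h *\<^sub>R One)) \<phi> /\<^sub>R h ^ DIM(real) - \<phi> x) < e"
    using integrable_ccontinuous_explicit[of \<phi>] int by auto
  have "(\<lambda>x. \<phi> (- x)) integrable_on {a..b}" for a b
    using int[of "- b" "- a"] Henstock_Kurzweil_Integration.integrable_reflect_real[of \<phi> "- a" "- b"] by simp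
  then obtain N2 where N2: "negligible N2"
    "\<And>x e. \<lbrakk>x \<notin> N2; 0 < e\<rbrakk> \<Longrightarrow> \<exists>d>0. \<forall>h. 0 < h \<and> h < d \<longrightarrow>
       norm (integral (cbox x (x + h *\<^sub>R One)) (\<lambda>x. \<phi> (- x)) /\<^sub>R h ^ DIM(real) - \<phi> (- x)) < e"
    using integrable_ccontinuous_explicit[of "\<lambda>x. \<phi> (- x)"] by auto
  have "negligible (N1 \<union> uminus ` N2)"
    using N1(1) N2(1)
    by (intro negligible_Un negligible_differentiable_image_negligible differentiable_on_minus differentiable_on_ident) auto
  then have "AE x in lebesgue. x \<notin> N1 \<union> uminus ` N2"
    by (intro AE_not_in) (simp add: negligible_iff_null_sets)
  then show ?thesis
  proof eventually_elim
    case (elim x)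
    show ?case
      unfolding has_vector_derivative_def has_derivative_within_alt
    proof (intro impI conjI allI bounded_linear_scaleR_left)
      fix e :: real assume x: "x \<in> {a..b}" and e: "0 < e"
      have "x \<notin> N1" "- x \<notin> N2" using elim by force+
      then obtain d1 d2 where d: "d1 > 0" "d2 > 0"
        and d1: "\<And>h. \<lbrakk>0 < h; h < d1\<rbrakk> \<Longrightarrow> norm (integral {x..x + h} \<phi> /\<^sub>R h - \<phi> x) < e"
        and d2: "\<And>h. \<lbrakk>0 < h; h < d2\<rbrakk> \<Longrightarrow> norm (integral {- x..- x + h} (\<lambda>x. \<phi> (- x)) /\<^sub>R h - \<phi> x) < e"
        using N1(2)[OF _ e, of x] N2(2)[OF _ e, of "- x"] by auto
      have scale: "norm (I - h *\<^sub>R \<phi> x) \<le> e * h" if "norm (I /\<^sub>R h - \<phi> x) < e" "h > 0" for I h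
      proof -
        have "I - h *\<^sub>R \<phi> x = h *\<^sub>R (I /\<^sub>R h - \<phi> x)" using that by (simp add: algebra_simps)
        then show ?thesis using that by (simp add: mult.commute)
      qed
      show "\<exists>d>0. \<forall>y\<in>{a..b}. norm (y - x) < d \<longrightarrow>
        norm (integral {a..y} \<phi> - integral {a..x} \<phi> - (y - x) *\<^sub>R \<phi> x) \<le> e * norm (y - x)"
      proof (intro exI[of _ "min d1 d2"] conjI ballI impI)
        fix y assume y: "y \<in> {a..b}" "norm (y - x) < min d1 d2"
        consider "y = x" | "x < y" | "y < x" by linarith
        then show "norm (integral {a..y} \<phi> - integral {a..x} \<phi> - (y - x) *\<^sub>R \<phi> x) \<le> e * norm (y - x)"
        proof cases
          case 2
          have "integral {a..x} \<phi> + integral {x..y} \<phi> = integral {a..y} \<phi>"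
            using x 2 by (intro Henstock_Kurzweil_Integration.integral_combine int) auto
          then have "integral {a..y} \<phi> - integral {a..x} \<phi> - (y - x) *\<^sub>R \<phi> x = integral {x..x + (y - x)} \<phi> - (y - x) *\<^sub>R \<phi> x"
            by (metis add_diff_cancel_left' add.commute diff_add_cancel)
          then show ?thesis using scale[OF d1[of "y - x"]] 2 y by simp
        next
          case 3
          have i: "integral {a..y} \<phi> + integral {y..x} \<phi> = integral {a..x} \<phi>"
            using y 3 by (intro Henstock_Kurzweil_Integration.integral_combine int) auto
          have "integral {- x..- x + (x - y)} (\<lambda>x. \<phi> (- x)) = integral {y..x} \<phi>"
            using Henstock_Kurzweil_Integration.integral_reflect_real[of x y \<phi>] by simp
          then have "norm (integral {y..x} \<phi> - (x - y) *\<^sub>R \<phi> x) \<le> e * (x - y)"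
            using scale[OF d2[of "x - y"]] 3 y by simp
          moreover have "integral {a..y} \<phi> - integral {a..x} \<phi> - (y - x) *\<^sub>R \<phi> x = - (integral {y..x} \<phi> - (x - y) *\<^sub>R \<phi> x)"
            unfolding i[symmetric] by (simp add: algebra_simps)
          ultimately show ?thesis using 3 by (simp only: norm_minus_cancel) simp
        qed simp
      qed (use d in simp)
    qed
  qed
qed

section \<open>Composition of fractional integrals by Fubini\<close>

lemma borel_imp_lebesgue_measurable:
  assumes "\<phi> \<in> measurable borel N"
  shows "\<phi> \<in> measurable lebesgue N"
  by (rule measurable_completion) (simp add: assms)

lemma integrable_frac_kernel_lborel:
  fixes \<phi> :: "real \<Rightarrow> 'a::euclidean_space"
  assumes "0 < \<beta>" and m: "\<phi> \<in> borel_measurable borel" and "\<And>\<xi>. norm (\<phi> \<xi>) \<le> C"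
  shows "integrable lborel (\<lambda>\<xi>. indicator {0..\<tau>} \<xi> *\<^sub>R ((1 / (\<tau> - \<xi>) powr (1 - \<beta>)) *\<^sub>R \<phi> \<xi>))"
proof -
  have "\<phi> \<in> borel_measurable lebesgue" using m by (rule borel_imp_lebesgue_measurable)
  then have "integrable lebesgue (\<lambda>\<xi>. indicator {0..\<tau>} \<xi> *\<^sub>R ((1 / (\<tau> - \<xi>) powr (1 - \<beta>)) *\<^sub>R \<phi> \<xi>))"
    using absolutely_integrable_frac_kernel[OF assms(1) order_refl _ assms(3), where \<tau>=\<tau> and a=0]
    by (simp add: set_integrable_def)
  moreover have "(\<lambda>\<xi>. indicator {0..\<tau>} \<xi> *\<^sub>R ((1 / (\<tau> - \<xi>) powr (1 - \<beta>)) *\<^sub>R \<phi> \<xi>)) \<in> borel_measurable lborel"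
    using m by measurable
  ultimately show ?thesis by (simp only: integrable_completion)
qed

lemma frac_int_eq_lborel:
  fixes \<phi> :: "real \<Rightarrow> 'a::euclidean_space"
  assumes m: "\<phi> \<in> borel_measurable borel"
  shows "frac_int \<beta> \<phi> \<tau> = (1 / Gamma \<beta>) *\<^sub>R
    (\<integral>\<xi>. indicator {0..\<tau>} \<xi> *\<^sub>R ((1 / (\<tau> - \<xi>) powr (1 - \<beta>)) *\<^sub>R \<phi> \<xi>) \<partial>lborel)"
  unfolding frac_int_def set_lebesgue_integral_def using m by (subst integral_completion) auto

text \<open>\<open>H\<close> lives on the triangle
  \<open>0 \<le> \<xi> \<le> s \<le> \<tau>\<close>, the indicators inside \<open>K\<close> and
  \<open>k\<close> encoding its sides. Integrating first in \<open>\<xi>\<close> gives the iterated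
  fractional integral up to Gamma factors; integrating first in \<open>s\<close> leaves the Beta
  integral, a constant, times \<open>\<phi> \<xi>\<close>.\<close>

lemma frac_int_frac_int:
  fixes \<phi> :: "real \<Rightarrow> 'a::euclidean_space"
  assumes \<alpha>: "0 < \<alpha>" "\<alpha> < 1" and m[measurable]: "\<phi> \<in> borel_measurable borel"
    and C: "\<And>\<xi>. norm (\<phi> \<xi>) \<le> C"
  shows "frac_int (1 - \<alpha>) (frac_int \<alpha> \<phi>) \<tau> = integral {0..\<tau>} \<phi>"
proof -
  have C0: "C \<ge> 0" using C[of 0] norm_ge_zero order_trans by blast
  define k where "k = (\<lambda>s \<xi>::real. indicator {0..s} \<xi> * (1 / (s - \<xi>) powr (1 - \<alpha>)) :: real)"
  define K where "K = (\<lambda>s::real. indicator {0..\<tau>} s * (1 / (\<tau> - s) powr \<alpha>) :: real)"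
  define H where "H = (\<lambda>(s::real, \<xi>::real). (K s * k s \<xi>) *\<^sub>R \<phi> \<xi>)"
  have km: "(\<lambda>x::real\<times>real. k (fst x) (snd x)) \<in> borel_measurable (lborel \<Otimes>\<^sub>M lborel)"
    unfolding k_def indicator_def atLeastAtMost_iff by measurable
  have Km[measurable]: "K \<in> borel_measurable borel"
    unfolding K_def by measurable
  note [measurable] = km
  have Hm[measurable]: "H \<in> borel_measurable (lborel \<Otimes>\<^sub>M lborel)"
    unfolding H_def case_prod_beta by measurable
  have kp: "k s \<xi> \<ge> 0" "K s \<ge> 0" for s \<xi> by (auto simp: k_def K_def)
  \<comment> \<open>These two facts give the absolute integrability that Fubini requires. The
    absolute value covers negative \<open>s\<close>, for which \<open>k s\<close> is identically
    0.\<close>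
  have k_int: "integrable lborel (k s)" and k_val: "(\<integral>\<xi>. k s \<xi> \<partial>lborel) \<le> \<bar>s\<bar> powr \<alpha> / \<alpha>" for s
  proof -
    show i: "integrable lborel (k s)"
      using integrable_frac_kernel_lborel[OF \<alpha>(1), of "\<lambda>_. 1::real" 1 s] by (simp add: k_def)
    show "(\<integral>\<xi>. k s \<xi> \<partial>lborel) \<le> \<bar>s\<bar> powr \<alpha> / \<alpha>"
    proof (cases "s \<ge> 0")
      case True
      have "((\<lambda>\<xi>. 1 / (s - \<xi>) powr (1 - \<alpha>)) has_integral (s powr \<alpha> / \<alpha>)) {0..s}"
        using has_integral_frac_kernel[OF \<alpha>(1) True order_refl] by simp
      then have "(k s has_integral (s powr \<alpha> / \<alpha>)) UNIV"
      proof -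
        have "k s = (\<lambda>\<xi>. if \<xi> \<in> {0..s} then 1 / (s - \<xi>) powr (1 - \<alpha>) else 0)"
          by (auto simp: k_def fun_eq_iff)
        then show ?thesis
          using \<open>((\<lambda>\<xi>. 1 / (s - \<xi>) powr (1 - \<alpha>)) has_integral (s powr \<alpha> / \<alpha>)) {0..s}\<close>
          by (simp only: has_integral_restrict_UNIV)
      qed
      moreover have "(k s has_integral (\<integral>\<xi>. k s \<xi> \<partial>lborel)) UNIV"
        by (rule has_integral_integral_lborel[OF i])
      ultimately have "s powr \<alpha> / \<alpha> = (\<integral>\<xi>. k s \<xi> \<partial>lborel)"
        by (rule has_integral_unique)
      then show ?thesis using True by simp
    qed (use \<alpha> in \<open>simp add: k_def\<close>)
  qed
  have K_int: "integrable lborel K"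
    using integrable_frac_kernel_lborel[of "1 - \<alpha>" "\<lambda>_. 1::real" 1 \<tau>] \<alpha> by (simp add: K_def)
  have H_bound: "norm (H (s, \<xi>)) \<le> K s * C * k s \<xi>" for s \<xi>
  proof -
    have "norm (H (s, \<xi>)) = K s * (k s \<xi> * norm (\<phi> \<xi>))" using kp by (simp add: H_def abs_mult)
    also have "\<dots> \<le> K s * (k s \<xi> * C)" using kp C by (intro mult_left_mono) auto
    finally show ?thesis by (simp add: mult_ac)
  qed
  have H_int1: "integrable lborel (\<lambda>\<xi>. H (s, \<xi>))" for s
  proof (rule Bochner_Integration.integrable_bound)
    show "integrable lborel (\<lambda>\<xi>. K s * C * k s \<xi>)" by (intro integrable_mult_right k_int)
    show "AE \<xi> in lborel. norm (H (s, \<xi>)) \<le> norm (K s * C * k s \<xi>)"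
      using H_bound by (intro AE_I2) (metis abs_ge_self order_trans real_norm_def)
  qed measurable
  have H_int: "integrable (lborel \<Otimes>\<^sub>M lborel) H"
  proof (rule lborel_pair.Fubini_integrable[OF Hm])
    show "AE s in lborel. integrable lborel (\<lambda>\<xi>. H (s, \<xi>))" using H_int1 by simp
    show "integrable lborel (\<lambda>s. \<integral>\<xi>. norm (H (s, \<xi>)) \<partial>lborel)"
    proof (rule Bochner_Integration.integrable_bound)
      show "integrable lborel (\<lambda>s. C * (\<bar>\<tau>\<bar> powr \<alpha> / \<alpha>) * K s)" by (intro integrable_mult_right K_int)
      show "AE s in lborel. norm (\<integral>\<xi>. norm (H (s, \<xi>)) \<partial>lborel) \<le> norm (C * (\<bar>\<tau>\<bar> powr \<alpha> / \<alpha>) * K s)"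
      proof (rule AE_I2)
        fix s
        have "(\<integral>\<xi>. norm (H (s, \<xi>)) \<partial>lborel) \<le> (\<integral>\<xi>. K s * C * k s \<xi> \<partial>lborel)"
          by (intro integral_mono integrable_norm H_int1 integrable_mult_right k_int H_bound)
        also have "\<dots> = K s * C * (\<integral>\<xi>. k s \<xi> \<partial>lborel)" by simp
        also have "\<dots> \<le> K s * C * (\<bar>\<tau>\<bar> powr \<alpha> / \<alpha>)"
        proof (cases "s \<in> {0..\<tau>}")
          case True
          then have "\<bar>s\<bar> powr \<alpha> / \<alpha> \<le> \<bar>\<tau>\<bar> powr \<alpha> / \<alpha>" using \<alpha> by (auto intro!: divide_right_mono powr_mono2)
          then show ?thesis using k_val[of s] kp C0 by (intro mult_left_mono) auto
        qed (simp add: K_def)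
        finally show "norm (\<integral>\<xi>. norm (H (s, \<xi>)) \<partial>lborel) \<le> norm (C * (\<bar>\<tau>\<bar> powr \<alpha> / \<alpha>) * K s)"
          using kp C0 \<alpha> by (simp add: abs_mult mult_ac)
      qed
    qed measurable
  qed
  have inner: "(\<integral>\<xi>. H (s, \<xi>) \<partial>lborel) = K s *\<^sub>R (Gamma \<alpha> *\<^sub>R frac_int \<alpha> \<phi> s)" for s
  proof -
    have "H (s, \<xi>) = K s *\<^sub>R (indicator {0..s} \<xi> *\<^sub>R ((1 / (s - \<xi>) powr (1 - \<alpha>)) *\<^sub>R \<phi> \<xi>))" for \<xi>
      by (simp add: H_def k_def)
    then have "(\<integral>\<xi>. H (s, \<xi>) \<partial>lborel) = K s *\<^sub>R
        (\<integral>\<xi>. indicator {0..s} \<xi> *\<^sub>R ((1 / (s - \<xi>) powr (1 - \<alpha>)) *\<^sub>R \<phi> \<xi>) \<partial>lborel)"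
      by (simp only: integral_scaleR_right)
    then show ?thesis using Gamma_real_pos[OF \<alpha>(1)] by (simp add: frac_int_eq_lborel[OF m])
  qed
  \<comment> \<open>For \<open>\<xi> = \<tau>\<close> the slice of the triangle is a single point
    and the left side is 0, while the right side may be nonzero; this null set is left out.\<close>
  have outer: "(\<integral>s. H (s, \<xi>) \<partial>lborel) = (Gamma \<alpha> * Gamma (1 - \<alpha>)) *\<^sub>R (indicator {0..\<tau>} \<xi> *\<^sub>R \<phi> \<xi>)" if "\<xi> \<noteq> \<tau>" for \<xi>
  proof (cases "0 \<le> \<xi> \<and> \<xi> < \<tau>")
    case True
    have "((\<lambda>s. K s * k s \<xi>) has_integral Gamma \<alpha> * Gamma (1 - \<alpha>)) UNIV"
    proof -
      have "((\<lambda>s. if s \<in> {\<xi>..\<tau>} then (1 / (\<tau> - s) powr \<alpha>) * (1 / (s - \<xi>) powr (1 - \<alpha>)) else 0) has_integral Gamma \<alpha> * Gamma (1 - \<alpha>)) UNIV"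
        using has_integral_Beta_kernel[OF \<alpha>, of \<xi> \<tau>] True by (subst has_integral_restrict_UNIV) auto
      moreover have "(\<lambda>s. if s \<in> {\<xi>..\<tau>} then (1 / (\<tau> - s) powr \<alpha>) * (1 / (s - \<xi>) powr (1 - \<alpha>)) else 0) = (\<lambda>s. K s * k s \<xi>)"
        using True by (auto simp: K_def k_def fun_eq_iff)
      ultimately show ?thesis by simp
    qed
    moreover have "(\<lambda>s. K s * k s \<xi>) \<in> borel_measurable borel"
      unfolding k_def indicator_def atLeastAtMost_iff by measurable
    ultimately have "(\<integral>\<^sup>+s. ennreal (K s * k s \<xi>) \<partial>lborel) = ennreal (Gamma \<alpha> * Gamma (1 - \<alpha>))"
      using kp by (intro nn_integral_has_integral_lborel) auto
    then have "(\<integral>s. K s * k s \<xi> \<partial>lborel) = Gamma \<alpha> * Gamma (1 - \<alpha>)"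
      using kp \<alpha> Gamma_real_pos[of \<alpha>] Gamma_real_pos[of "1 - \<alpha>"] \<open>(\<lambda>s. K s * k s \<xi>) \<in> borel_measurable borel\<close>
      by (subst integral_eq_nn_integral) auto
    \<comment> \<open>The Bochner integral of a nonintegrable function is 0 by convention, so a
      positive value already proves integrability.\<close>
    moreover have "integrable lborel (\<lambda>s. K s * k s \<xi>)"
      using calculation Gamma_real_pos[of \<alpha>] Gamma_real_pos[of "1 - \<alpha>"] \<alpha> not_integrable_integral_eq[of lborel "\<lambda>s. K s * k s \<xi>"]
      by fastforce
    ultimately show ?thesis using True by (simp add: H_def)
  next
    case False
    then have "K s * k s \<xi> = 0" for s using that by (auto simp: K_def k_def indicator_def)
    then have "H (s, \<xi>) = 0" for s by (simp only: H_def case_prod_conv scaleR_zero_left)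
    moreover have "indicat_real {0..\<tau>} \<xi> = 0" using False that by (auto simp: indicator_def)
    ultimately show ?thesis by simp
  qed
  have fub: "(\<integral>\<xi>. (\<integral>s. H (s, \<xi>) \<partial>lborel) \<partial>lborel) = (\<integral>s. (\<integral>\<xi>. H (s, \<xi>) \<partial>lborel) \<partial>lborel)"
    using lborel_pair.Fubini_integral[of "\<lambda>s \<xi>. H (s, \<xi>)"] H_int by simp
  have i1: "set_integrable lborel {0..\<tau>} \<phi>"
  proof -
    have i: "integrable lborel (\<lambda>\<xi>. indicator {0..\<tau>} \<xi> * C)"
      by (intro integrable_mult_left integrable_real_indicator) (auto simp: emeasure_lborel_Icc_eq)
    show ?thesis unfolding set_integrable_def
      by (rule Bochner_Integration.integrable_bound[OF i])
        (use C C0 in \<open>auto intro!: AE_I2 simp: indicator_def\<close>)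
  qed
  have "(\<integral>\<xi>. (\<integral>s. H (s, \<xi>) \<partial>lborel) \<partial>lborel) = (\<integral>\<xi>. (Gamma \<alpha> * Gamma (1 - \<alpha>)) *\<^sub>R (indicator {0..\<tau>} \<xi> *\<^sub>R \<phi> \<xi>) \<partial>lborel)"
  proof (rule integral_cong_AE)
    show "AE \<xi> in lborel. (\<integral>s. H (s, \<xi>) \<partial>lborel) = (Gamma \<alpha> * Gamma (1 - \<alpha>)) *\<^sub>R (indicator {0..\<tau>} \<xi> *\<^sub>R \<phi> \<xi>)"
      using AE_lborel_singleton[of \<tau>] by eventually_elim (rule outer)
  qed measurable
  also have "\<dots> = (Gamma \<alpha> * Gamma (1 - \<alpha>)) *\<^sub>R integral {0..\<tau>} \<phi>"
    unfolding integral_scaleR_right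
    using set_borel_integral_eq_integral(2)[OF i1] by (simp only: set_lebesgue_integral_def)
  finally have "(Gamma \<alpha> * Gamma (1 - \<alpha>)) *\<^sub>R integral {0..\<tau>} \<phi> = (\<integral>s. K s *\<^sub>R (Gamma \<alpha> *\<^sub>R frac_int \<alpha> \<phi> s) \<partial>lborel)"
    by (simp add: fub inner)
  also have "\<dots> = Gamma \<alpha> *\<^sub>R (\<integral>s. K s *\<^sub>R frac_int \<alpha> \<phi> s \<partial>lborel)"
    by (simp only: scaleR_left_commute[of "K _" "Gamma \<alpha>"] integral_scaleR_right)
  finally have "Gamma \<alpha> *\<^sub>R (Gamma (1 - \<alpha>) *\<^sub>R integral {0..\<tau>} \<phi>) = Gamma \<alpha> *\<^sub>R (\<integral>s. K s *\<^sub>R frac_int \<alpha> \<phi> s \<partial>lborel)"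
    by (simp only: scaleR_scaleR)
  then have eq: "(\<integral>s. K s *\<^sub>R frac_int \<alpha> \<phi> s \<partial>lborel) = Gamma (1 - \<alpha>) *\<^sub>R integral {0..\<tau>} \<phi>"
    using scaleR_left_imp_eq Gamma_real_pos[OF \<alpha>(1)] by (metis less_irrefl)
  have fm: "(\<lambda>s. K s *\<^sub>R frac_int \<alpha> \<phi> s) \<in> borel_measurable lborel"
  proof -
    have "(\<lambda>s. (1 / Gamma \<alpha>) *\<^sub>R (\<integral>\<xi>. H (s, \<xi>) \<partial>lborel)) \<in> borel_measurable lborel" by measurable
    then show ?thesis using Gamma_real_pos[OF \<alpha>(1)] by (simp add: inner)
  qed
  have "frac_int (1 - \<alpha>) (frac_int \<alpha> \<phi>) \<tau> = (1 / Gamma (1 - \<alpha>)) *\<^sub>R (\<integral>s. K s *\<^sub>R frac_int \<alpha> \<phi> s \<partial>lebesgue)"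
    by (simp add: frac_int_def set_lebesgue_integral_def K_def)
  also have "\<dots> = (1 / Gamma (1 - \<alpha>)) *\<^sub>R (\<integral>s. K s *\<^sub>R frac_int \<alpha> \<phi> s \<partial>lborel)"
    by (subst integral_completion[OF fm]) simp
  finally show ?thesis using eq Gamma_real_pos[of "1 - \<alpha>", THEN less_imp_neq] \<alpha> by simp
qed

text \<open>\<open>completion_ex_borel_measurable_real\<close> supplies Borel representatives of
  real functions; the coordinates are treated one at a time, and the finitely many null sets are
  merged.\<close>

lemma lebesgue_measurable_eq_AE_borel:
  fixes \<psi> :: "'b::euclidean_space \<Rightarrow> 'a::euclidean_space"
  assumes "\<psi> \<in> borel_measurable lebesgue"
  obtains \<phi> where "\<phi> \<in> borel_measurable borel" "AE \<xi> in lebesgue. \<psi> \<xi> = \<phi> \<xi>"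
proof -
  have "\<exists>g\<in>borel_measurable lborel. AE x in lborel. \<psi> x \<bullet> i = g x" for i
    using assms by (intro completion_ex_borel_measurable_real borel_measurable_inner) auto
  then obtain g where g: "\<And>i. g i \<in> borel_measurable lborel" "\<And>i. AE x in lborel. \<psi> x \<bullet> i = g i x"
    by metis
  show thesis
  proof
    show "(\<lambda>x. \<Sum>i\<in>Basis. g i x *\<^sub>R i) \<in> borel_measurable borel"
      using g(1) by (intro borel_measurable_sum borel_measurable_scaleR) auto
    have "AE x in lborel. \<forall>i\<in>Basis. \<psi> x \<bullet> i = g i x"
      using g(2) by (intro AE_finite_allI) auto
    then have "AE x in lborel. \<psi> x = (\<Sum>i\<in>Basis. g i x *\<^sub>R i)"
    proof eventually_elim
      case (elim x)
      have "\<psi> x = (\<Sum>i\<in>Basis. (\<psi> x \<bullet> i) *\<^sub>R i)" by (simp only: euclidean_representation)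
      also have "\<dots> = (\<Sum>i\<in>Basis. g i x *\<^sub>R i)" using elim by (intro sum.cong) auto
      finally show ?case .
    qed
    then show "AE x in lebesgue. \<psi> x = (\<Sum>i\<in>Basis. g i x *\<^sub>R i)"
      by (rule AE_completion)
  qed
qed

text \<open>Replacing the representative by 0 wherever it exceeds \<open>C\<close> changes it on a
  null set only and turns an essential bound into a bound at every point.\<close>

lemma bounded_lebesgue_measurable_eq_AE_borel:
  fixes \<psi> :: "'b::euclidean_space \<Rightarrow> 'a::euclidean_space"
  assumes "\<psi> \<in> borel_measurable lebesgue" "AE \<xi> in lebesgue. norm (\<psi> \<xi>) \<le> C" "0 \<le> C"
  obtains \<phi> where "\<phi> \<in> borel_measurable borel" "\<And>\<xi>. norm (\<phi> \<xi>) \<le> C" "AE \<xi> in lebesgue. \<psi> \<xi> = \<phi> \<xi>"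
proof -
  obtain \<phi> where \<phi>[measurable]: "\<phi> \<in> borel_measurable borel" and eq: "AE \<xi> in lebesgue. \<psi> \<xi> = \<phi> \<xi>"
    using lebesgue_measurable_eq_AE_borel[OF assms(1)] .
  show thesis
  proof
    show "(\<lambda>\<xi>. if norm (\<phi> \<xi>) \<le> C then \<phi> \<xi> else 0) \<in> borel_measurable borel" by measurable
    show "norm (if norm (\<phi> \<xi>) \<le> C then \<phi> \<xi> else 0) \<le> C" for \<xi> using assms(3) by auto
    show "AE \<xi> in lebesgue. \<psi> \<xi> = (if norm (\<phi> \<xi>) \<le> C then \<phi> \<xi> else 0)"
      using eq assms(2) by eventually_elim auto
  qed
qed

text \<open>The density is extended by 0 and then exchanged for a Borel one bounded at every point.
  In this form it can be used both under Fubini and in pointwise estimates.\<close>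

lemma AC_frac_E:
  fixes x :: "real \<Rightarrow> 'a::euclidean_space"
  assumes "x \<in> AC_frac \<alpha> t" "0 \<le> t"
  obtains \<phi> C where "\<phi> \<in> borel_measurable borel" "\<And>\<xi>. norm (\<phi> \<xi>) \<le> C"
    "\<And>\<tau>. \<tau> \<in> {0..t} \<Longrightarrow> x \<tau> = x 0 + frac_int \<alpha> \<phi> \<tau>"
proof -
  obtain \<psi> where \<psi>: "\<psi> \<in> Linf t" and x: "\<And>\<tau>. \<tau> \<in> {0..t} \<Longrightarrow> x \<tau> = x 0 + frac_int \<alpha> \<psi> \<tau>"
    using assms unfolding AC_frac_def by blast
  define \<psi>' where "\<psi>' = (\<lambda>\<xi>. if \<xi> \<in> {0..t} then \<psi> \<xi> else 0)"
  have m: "\<psi>' \<in> borel_measurable lebesgue"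
    unfolding \<psi>'_def using \<psi> by (intro borel_measurable_if_I) (auto simp: Linf_def)
  obtain C where C: "0 \<le> C" "AE \<xi> in lebesgue. norm (\<psi>' \<xi>) \<le> C"
  proof (cases "t > 0")
    case True
    let ?e = "esssup (lebesgue_on {0..t}) (\<lambda>\<tau>. ereal (norm (\<psi> \<tau>)))"
    have "?e < \<infinity>" using \<psi> True by (simp add: Linf_def Linf_norm_def)
    then obtain C where C: "?e \<le> ereal C" by (cases ?e) auto
    have "AE \<tau> in lebesgue_on {0..t}. ereal (norm (\<psi> \<tau>)) \<le> ?e" by (rule esssup_AE)
    then have "AE \<tau> in lebesgue_on {0..t}. norm (\<psi> \<tau>) \<le> C"
    proof eventually_elim
      case (elim \<tau>)
      then show ?case using order_trans[OF elim C] by simp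
    qed
    then have "AE \<tau> in lebesgue. norm (\<psi>' \<tau>) \<le> \<bar>C\<bar>"
      by (subst (asm) AE_restrict_space_iff) (auto simp: \<psi>'_def elim!: eventually_mono)
    then show thesis by (rule that[OF abs_ge_zero])
  next
    case False
    \<comment> \<open>Now \<open>t = 0\<close>: the interval is a single point, no essential
      supremum is involved, and the extended density takes no values besides \<open>\<psi> 0\<close>
      and 0.\<close>
    with assms have "norm (\<psi>' \<xi>) \<le> norm (\<psi> 0)" for \<xi> by (simp add: \<psi>'_def)
    then show thesis by (intro that[of "norm (\<psi> 0)"]) auto
  qed
  obtain \<phi> where \<phi>: "\<phi> \<in> borel_measurable borel" "\<And>\<xi>. norm (\<phi> \<xi>) \<le> C" and eq: "AE \<xi> in lebesgue. \<psi>' \<xi> = \<phi> \<xi>"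
    by (rule bounded_lebesgue_measurable_eq_AE_borel[OF m C(2,1)]) (rule that)
  have "x \<tau> = x 0 + frac_int \<alpha> \<phi> \<tau>" if "\<tau> \<in> {0..t}" for \<tau>
  proof -
    have "frac_int \<alpha> \<psi> \<tau> = frac_int \<alpha> \<psi>' \<tau>"
      using that by (intro frac_int_cong) (auto simp: \<psi>'_def)
    also have "\<dots> = frac_int \<alpha> \<phi> \<tau>"
      using eq m borel_imp_lebesgue_measurable[OF \<phi>(1)] by (intro frac_int_cong_AE) auto
    finally show ?thesis using x[OF that] by (simp only:)
  qed
  then show thesis by (rule that[OF \<phi>])
qed

lemma AC_frac_I:
  fixes x :: "real \<Rightarrow> 'a::euclidean_space"
  assumes "x \<in> extensional {0..t}" and \<psi>: "\<psi> \<in> borel_measurable lebesgue" "\<And>\<xi>. norm (\<psi> \<xi>) \<le> C"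
    and x: "\<And>\<tau>. \<tau> \<in> {0..t} \<Longrightarrow> x \<tau> = x 0 + frac_int \<alpha> \<psi> \<tau>"
  shows "x \<in> AC_frac \<alpha> t"
proof -
  let ?\<psi> = "restrict \<psi> {0..t}"
  have [measurable]: "\<psi> \<in> borel_measurable (lebesgue_on {0..t})"
    using \<psi>(1) by (rule measurable_restrict_space1)
  have m[measurable]: "?\<psi> \<in> borel_measurable (lebesgue_on {0..t})"
    by (subst measurable_cong[of _ _ \<psi>]) auto
  have "Linf_norm t ?\<psi> < \<infinity>"
  proof (cases "t > 0")
    case True
    have "esssup (lebesgue_on {0..t}) (\<lambda>\<tau>. ereal (norm (?\<psi> \<tau>))) \<le> ereal C"
      using \<psi>(2) by (intro esssup_I AE_I2 borel_measurable_ereal measurable_compose[OF m borel_measurable_norm]) auto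
    also have "\<dots> < \<infinity>" by simp
    finally show ?thesis using True by (simp add: Linf_norm_def)
  qed (simp add: Linf_norm_def)
  then have "?\<psi> \<in> Linf t" using m by (simp add: Linf_def)
  moreover have "x \<tau> = x 0 + frac_int \<alpha> ?\<psi> \<tau>" if "\<tau> \<in> {0..t}" for \<tau>
  proof -
    have "frac_int \<alpha> ?\<psi> \<tau> = frac_int \<alpha> \<psi> \<tau>" using that by (intro frac_int_cong) auto
    then show ?thesis using x[OF that] by simp
  qed
  ultimately show ?thesis using assms(1) unfolding AC_frac_def by blast
qed

text \<open>The exchange of \<open>\<psi>\<close> for a Borel \<open>\<phi>\<close> is exact inside
  the fractional integral, at every time; only the identification of the derivative
  \<open>\<phi> \<tau>\<close> with \<open>\<psi> \<tau>\<close> costs a null set.\<close>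

lemma has_caputo_derivative_frac_int_AE:
  fixes x :: "real \<Rightarrow> 'a::euclidean_space"
  assumes \<alpha>: "0 < \<alpha>" "\<alpha> < 1" and \<psi>: "\<psi> \<in> borel_measurable lebesgue" "\<And>\<xi>. norm (\<psi> \<xi>) \<le> C"
    and x: "\<And>\<tau>. \<tau> \<in> {0..t} \<Longrightarrow> x \<tau> = x 0 + frac_int \<alpha> \<psi> \<tau>"
  shows "AE \<tau> in lebesgue. \<tau> \<in> {0..t} \<longrightarrow> has_caputo_derivative \<alpha> t x (\<psi> \<tau>) \<tau>"
proof -
  have "C \<ge> 0" using \<psi>(2)[of 0] norm_ge_zero order_trans by blast
  then obtain \<phi> where \<phi>: "\<phi> \<in> borel_measurable borel" "\<And>\<xi>. norm (\<phi> \<xi>) \<le> C"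
    and eq: "AE \<xi> in lebesgue. \<psi> \<xi> = \<phi> \<xi>"
    by (rule bounded_lebesgue_measurable_eq_AE_borel[OF \<psi>(1) AE_I2[OF \<psi>(2)]]) (rule that)
  have \<phi>m: "\<phi> \<in> borel_measurable lebesgue" using \<phi>(1) by (rule borel_imp_lebesgue_measurable)
  have ff: "frac_int \<alpha> \<psi> \<tau> = frac_int \<alpha> \<phi> \<tau>" for \<tau>
    using eq by (intro frac_int_cong_AE \<psi> \<phi>m) auto
  have I: "frac_int (1 - \<alpha>) (\<lambda>\<xi>. x \<xi> - x 0) \<tau> = integral {0..\<tau>} \<phi>" if "\<tau> \<in> {0..t}" for \<tau>
  proof -
    have "x \<xi> - x 0 = frac_int \<alpha> \<phi> \<xi>" if "0 \<le> \<xi>" "\<xi> < \<tau>" for \<xi>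
      using x[of \<xi>] that \<open>\<tau> \<in> {0..t}\<close> ff by simp
    then have "frac_int (1 - \<alpha>) (\<lambda>\<xi>. x \<xi> - x 0) \<tau> = frac_int (1 - \<alpha>) (frac_int \<alpha> \<phi>) \<tau>"
      by (rule frac_int_cong)
    then show ?thesis using frac_int_frac_int[OF \<alpha> \<phi>] by simp
  qed
  have "\<phi> integrable_on {a..b}" for a b
    using \<phi>(2) \<phi>m by (intro measurable_bounded_by_integrable_imp_integrable[of \<phi> _ "\<lambda>_. C"])
      (auto intro: measurable_restrict_space1)
  then have "AE \<tau> in lebesgue. \<tau> \<in> {0..t} \<longrightarrow>
    ((\<lambda>\<tau>. integral {0..\<tau>} \<phi>) has_vector_derivative \<phi> \<tau>) (at \<tau> within {0..t})"
    by (rule has_vector_derivative_indefinite_integral_AE)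
  then show ?thesis using eq
  proof eventually_elim
    case (elim \<tau>)
    show ?case unfolding has_caputo_derivative_def
    proof
      assume \<tau>: "\<tau> \<in> {0..t}"
      show "(frac_int (1 - \<alpha>) (\<lambda>\<xi>. x \<xi> - x 0) has_vector_derivative \<psi> \<tau>) (at \<tau> within {0..t})"
        by (rule has_vector_derivative_transform[OF \<tau> I]) (use elim \<tau> in auto)
    qed
  qed
qed

text \<open>In a nondegenerate interval every point is a limit point, so the derivative within the
  interval is determined. For \<open>t = 0\<close> every vector would be a derivative.\<close>

lemma has_caputo_derivative_unique:
  fixes x :: "real \<Rightarrow> 'a::euclidean_space"
  assumes "has_caputo_derivative \<alpha> t x d \<tau>" "has_caputo_derivative \<alpha> t x d' \<tau>" "\<tau> \<in> {0..t}" "0 < t"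
  shows "d = d'"
proof -
  have "at \<tau> within {0..t} \<noteq> bot"
    using assms(3,4) by (simp add: trivial_limit_within islimpt_Icc)
  then show ?thesis
    using vector_derivative_unique_within assms(1,2) unfolding has_caputo_derivative_def by metis
qed

lemma has_caputo_derivative_restrict:
  fixes x y :: "real \<Rightarrow> 'a::euclidean_space"
  assumes "has_caputo_derivative \<alpha> \<theta> x d \<tau>" "\<tau> \<in> {0..t}" "t \<le> \<theta>" "\<And>s. s \<in> {0..t} \<Longrightarrow> y s = x s"
  shows "has_caputo_derivative \<alpha> t y d \<tau>"
  unfolding has_caputo_derivative_def
proof (rule has_vector_derivative_transform[OF assms(2)])
  show "(frac_int (1 - \<alpha>) (\<lambda>\<xi>. x \<xi> - x 0) has_vector_derivative d) (at \<tau> within {0..t})"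
    using assms(1) unfolding has_caputo_derivative_def
    by (rule has_vector_derivative_within_subset) (use assms(3) in auto)
  show "frac_int (1 - \<alpha>) (\<lambda>\<xi>. y \<xi> - y 0) s = frac_int (1 - \<alpha>) (\<lambda>\<xi>. x \<xi> - x 0) s" if "s \<in> {0..t}" for s
    using that assms(4) by (intro frac_int_cong) auto
qed

section \<open>Fractional Volterra equations\<close>

lemma frac_int_diff:
  fixes \<psi> \<phi> :: "real \<Rightarrow> 'a::euclidean_space"
  assumes "0 < \<beta>" and \<psi>: "\<psi> \<in> borel_measurable lebesgue" "\<And>\<xi>. norm (\<psi> \<xi>) \<le> C"
    and \<phi>: "\<phi> \<in> borel_measurable lebesgue" "\<And>\<xi>. norm (\<phi> \<xi>) \<le> D"
  shows "frac_int \<beta> (\<lambda>\<xi>. \<psi> \<xi> - \<phi> \<xi>) \<tau> = frac_int \<beta> \<psi> \<tau> - frac_int \<beta> \<phi> \<tau>"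
proof -
  have "(LINT \<xi>:{0..\<tau>}|lebesgue. (1 / (\<tau> - \<xi>) powr (1 - \<beta>)) *\<^sub>R \<psi> \<xi> - (1 / (\<tau> - \<xi>) powr (1 - \<beta>)) *\<^sub>R \<phi> \<xi>)
     = (LINT \<xi>:{0..\<tau>}|lebesgue. (1 / (\<tau> - \<xi>) powr (1 - \<beta>)) *\<^sub>R \<psi> \<xi>) -
       (LINT \<xi>:{0..\<tau>}|lebesgue. (1 / (\<tau> - \<xi>) powr (1 - \<beta>)) *\<^sub>R \<phi> \<xi>)"
    by (intro set_integral_diff absolutely_integrable_frac_kernel[OF assms(1) order_refl \<psi>]
        absolutely_integrable_frac_kernel[OF assms(1) order_refl \<phi>])
  then show ?thesis by (simp only: frac_int_def scaleR_diff_right)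
qed

lemma frac_int_at_0: "frac_int \<beta> \<psi> 0 = 0"
proof -
  have "frac_int \<beta> \<psi> 0 = frac_int \<beta> (\<lambda>_. 0) 0" by (rule frac_int_cong) auto
  then show ?thesis by (simp add: frac_int_def set_lebesgue_integral_def)
qed

section \<open>Estimates in the exponentially weighted norm\<close>

lemma norm_frac_int_exp_le:
  fixes \<psi> :: "real \<Rightarrow> 'a::euclidean_space"
  assumes "0 < \<beta>" "0 < l" "0 \<le> \<tau>" "0 \<le> D"
    and \<psi>: "\<psi> \<in> borel_measurable lebesgue" "\<And>\<xi>. norm (\<psi> \<xi>) \<le> C"
    and le: "\<And>\<xi>. \<lbrakk>0 \<le> \<xi>; \<xi> < \<tau>\<rbrakk> \<Longrightarrow> norm (\<psi> \<xi>) \<le> D * exp (l * \<xi>)"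
  shows "norm (frac_int \<beta> \<psi> \<tau>) \<le> D / l powr \<beta> * exp (l * \<tau>)"
proof -
  have "norm (frac_int \<beta> \<psi> \<tau>) \<le>
    (1 / Gamma \<beta>) * integral {0..\<tau>} (\<lambda>\<xi>. (1 / (\<tau> - \<xi>) powr (1 - \<beta>)) * (D * exp (l * \<xi>)))"
    by (rule norm_frac_int_le[OF assms(1) \<psi> _ le]) (auto intro!: continuous_intros)
  also have "\<dots> = D * ((1 / Gamma \<beta>) * integral {0..\<tau>} (\<lambda>\<xi>. (1 / (\<tau> - \<xi>) powr (1 - \<beta>)) * exp (l * \<xi>)))"
    by (simp only: mult.left_commute[of _ D] integral_mult_right)
  also have "\<dots> \<le> D * (exp (l * \<tau>) / l powr \<beta>)"
    by (intro mult_left_mono integral_frac_kernel_exp_le assms)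
  finally show ?thesis by simp
qed

lemma exists_exp_weight:
  fixes \<beta> C :: real
  assumes "0 < \<beta>"
  obtains l where "0 < l" "C / l powr \<beta> \<le> 1 / 2"
proof
  \<comment> \<open>Chosen so that \<open>?l powr \<beta> = 2 * \<bar>C\<bar> + 1\<close>; the
    summand 1 keeps the weight positive when \<open>C = 0\<close>.\<close>
  let ?l = "(2 * \<bar>C\<bar> + 1) powr (1 / \<beta>)"
  show "0 < ?l" by simp
  have "?l powr \<beta> = 2 * \<bar>C\<bar> + 1" using assms by (simp add: powr_powr)
  moreover have "C / (2 * \<bar>C\<bar> + 1) \<le> 1 / 2" by (simp add: field_simps)
  ultimately show "C / ?l powr \<beta> \<le> 1 / 2" by simp
qed

text \<open>By compactness the quotient \<open>d \<xi> / exp (l * \<xi>)\<close> attains its maximum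
  at some \<open>s\<close>. The assumption \<open>step\<close>, used at \<open>s\<close> with
  \<open>m\<close> this maximum, bounds it by \<open>a + m / 2\<close>, so
  \<open>m \<le> 2 * a\<close>. One application at the maximum takes the place of an
  iteration.\<close>

lemma weighted_gronwall:
  fixes d :: "real \<Rightarrow> real"
  assumes cont: "continuous_on {0..\<theta>} d" and "0 \<le> a" "0 \<le> l"
    and step: "\<And>\<tau> m. \<lbrakk>\<tau> \<in> {0..\<theta>}; 0 \<le> m; \<And>\<xi>. \<lbrakk>0 \<le> \<xi>; \<xi> < \<tau>\<rbrakk> \<Longrightarrow> d \<xi> \<le> m * exp (l * \<xi>)\<rbrakk>
      \<Longrightarrow> d \<tau> \<le> a + m / 2 * exp (l * \<tau>)"
    and \<tau>: "\<tau> \<in> {0..\<theta>}"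
  shows "d \<tau> \<le> 2 * a * exp (l * \<tau>)"
proof -
  let ?q = "\<lambda>\<xi>. d \<xi> / exp (l * \<xi>)"
  have "\<exists>s\<in>{0..\<theta>}. \<forall>y\<in>{0..\<theta>}. ?q y \<le> ?q s"
    using \<tau> by (intro continuous_attains_sup continuous_intros cont) auto
  then obtain s where s: "s \<in> {0..\<theta>}" "\<And>y. y \<in> {0..\<theta>} \<Longrightarrow> ?q y \<le> ?q s" by blast
  \<comment> \<open>\<open>step\<close> accepts nonnegative \<open>m\<close> only, and
    \<open>d\<close> may take negative values.\<close>
  define m where "m = max 0 (?q s)"
  have m: "d \<xi> \<le> m * exp (l * \<xi>)" if "\<xi> \<in> {0..\<theta>}" for \<xi>
  proof -
    have "?q \<xi> \<le> m" using s(2)[OF that] by (simp add: m_def)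
    then show ?thesis by (simp add: field_simps)
  qed
  have "d s \<le> a + m / 2 * exp (l * s)"
    using s(1) m by (intro step) (auto simp: m_def)
  then have "?q s \<le> a / exp (l * s) + m / 2" by (simp add: field_simps)
  also have "a / exp (l * s) \<le> a / 1"
    using assms(2,3) s(1) by (intro divide_left_mono) auto
  finally have "m \<le> 2 * a" using assms(2) by (auto simp: m_def max_def split: if_splits)
  then have "m * exp (l * \<tau>) \<le> 2 * a * exp (l * \<tau>)" by simp
  with m[OF \<tau>] show ?thesis by linarith
qed

text \<open>The Gronwall argument is applied to \<open>1 + norm x\<close>, in which affine growth
  becomes linear. The resulting bound involves only \<open>l\<close>, \<open>\<theta>\<close> and
  the initial value. It is therefore common to all right-hand sides with the same growth constant,
  which is used both for truncating the equation and for uniformity in the control.\<close>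

lemma frac_ode_bound:
  fixes x \<psi> :: "real \<Rightarrow> 'a::euclidean_space"
  assumes "0 < \<alpha>" "0 < l" "0 \<le> C" "C / l powr \<alpha> \<le> 1 / 2"
    and cont: "continuous_on {0..\<theta>} x"
    and \<psi>: "\<psi> \<in> borel_measurable lebesgue" "\<And>\<xi>. norm (\<psi> \<xi>) \<le> B"
    and x: "\<And>\<tau>. \<tau> \<in> {0..\<theta>} \<Longrightarrow> x \<tau> = x0 + frac_int \<alpha> \<psi> \<tau>"
    and growth: "\<And>\<xi>. \<lbrakk>0 \<le> \<xi>; \<xi> < \<theta>\<rbrakk> \<Longrightarrow> norm (\<psi> \<xi>) \<le> C * (1 + norm (x \<xi>))"
    and \<tau>: "\<tau> \<in> {0..\<theta>}"
  shows "norm (x \<tau>) \<le> 2 * (1 + norm x0) * exp (l * \<theta>)"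
proof -
  have "1 + norm (x \<tau>) \<le> 2 * (1 + norm x0) * exp (l * \<tau>)"
  proof (rule weighted_gronwall[OF _ _ _ _ \<tau>])
    show "continuous_on {0..\<theta>} (\<lambda>\<xi>. 1 + norm (x \<xi>))" by (intro continuous_intros cont)
    fix \<tau> m assume \<tau>: "\<tau> \<in> {0..\<theta>}" and "0 \<le> m"
      and m: "\<And>\<xi>. \<lbrakk>0 \<le> \<xi>; \<xi> < \<tau>\<rbrakk> \<Longrightarrow> 1 + norm (x \<xi>) \<le> m * exp (l * \<xi>)"
    have "norm (frac_int \<alpha> \<psi> \<tau>) \<le> C * m / l powr \<alpha> * exp (l * \<tau>)"
    proof (rule norm_frac_int_exp_le[OF assms(1,2) _ _ \<psi>])
      fix \<xi> assume \<xi>: "0 \<le> \<xi>" "\<xi> < \<tau>"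
      have "norm (\<psi> \<xi>) \<le> C * (1 + norm (x \<xi>))" using \<xi> \<tau> by (intro growth) auto
      also have "\<dots> \<le> C * (m * exp (l * \<xi>))" using m[OF \<xi>] assms(3) by (intro mult_left_mono)
      finally show "norm (\<psi> \<xi>) \<le> C * m * exp (l * \<xi>)" by (simp add: mult.assoc)
    qed (use \<tau> assms(3) \<open>0 \<le> m\<close> in auto)
    also have "C * m / l powr \<alpha> * exp (l * \<tau>) = C / l powr \<alpha> * (m * exp (l * \<tau>))" by simp
    also have "\<dots> \<le> 1 / 2 * (m * exp (l * \<tau>))" using assms(4) \<open>0 \<le> m\<close> by (intro mult_right_mono) auto
    finally have "norm (frac_int \<alpha> \<psi> \<tau>) \<le> m / 2 * exp (l * \<tau>)" by simp
    then show "1 + norm (x \<tau>) \<le> 1 + norm x0 + m / 2 * exp (l * \<tau>)"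
      using norm_triangle_ineq[of x0 "frac_int \<alpha> \<psi> \<tau>"] x[OF \<tau>] by simp
  qed (use assms(2) in auto)
  also have "\<dots> \<le> 2 * (1 + norm x0) * exp (l * \<theta>)"
    using \<tau> assms(2) by (intro mult_left_mono) auto
  finally show ?thesis by simp
qed

text \<open>The Gronwall argument for \<open>norm (x - y)\<close> with \<open>a = 0\<close>. The
  Lipschitz estimate is asked for only along the two given solutions, so a constant valid on a ball
  containing both suffices.\<close>

lemma frac_ode_unique:
  fixes x y \<psi> \<phi> :: "real \<Rightarrow> 'a::euclidean_space"
  assumes "0 < \<alpha>" "0 \<le> L"
    and cont: "continuous_on {0..\<theta>} x" "continuous_on {0..\<theta>} y"
    and \<psi>: "\<psi> \<in> borel_measurable lebesgue" "\<And>\<xi>. norm (\<psi> \<xi>) \<le> B"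
    and \<phi>: "\<phi> \<in> borel_measurable lebesgue" "\<And>\<xi>. norm (\<phi> \<xi>) \<le> B"
    and x: "\<And>\<tau>. \<tau> \<in> {0..\<theta>} \<Longrightarrow> x \<tau> = x0 + frac_int \<alpha> \<psi> \<tau>"
    and y: "\<And>\<tau>. \<tau> \<in> {0..\<theta>} \<Longrightarrow> y \<tau> = x0 + frac_int \<alpha> \<phi> \<tau>"
    and lip: "\<And>\<xi>. \<lbrakk>0 \<le> \<xi>; \<xi> < \<theta>\<rbrakk> \<Longrightarrow> norm (\<psi> \<xi> - \<phi> \<xi>) \<le> L * norm (x \<xi> - y \<xi>)"
    and \<tau>: "\<tau> \<in> {0..\<theta>}"
  shows "x \<tau> = y \<tau>"
proof -
  obtain l where l: "0 < l" "L / l powr \<alpha> \<le> 1 / 2" using exists_exp_weight[OF assms(1)] .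
  have "norm (x \<tau> - y \<tau>) \<le> 2 * 0 * exp (l * \<tau>)"
  proof (rule weighted_gronwall[OF _ _ _ _ \<tau>])
    show "continuous_on {0..\<theta>} (\<lambda>\<xi>. norm (x \<xi> - y \<xi>))" by (intro continuous_intros cont)
    fix \<tau> m assume \<tau>: "\<tau> \<in> {0..\<theta>}" and "0 \<le> m"
      and m: "\<And>\<xi>. \<lbrakk>0 \<le> \<xi>; \<xi> < \<tau>\<rbrakk> \<Longrightarrow> norm (x \<xi> - y \<xi>) \<le> m * exp (l * \<xi>)"
    have "norm (frac_int \<alpha> (\<lambda>\<xi>. \<psi> \<xi> - \<phi> \<xi>) \<tau>) \<le> L * m / l powr \<alpha> * exp (l * \<tau>)"
    proof (rule norm_frac_int_exp_le[OF assms(1) l(1)])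
      fix \<xi> assume \<xi>: "0 \<le> \<xi>" "\<xi> < \<tau>"
      have "norm (\<psi> \<xi> - \<phi> \<xi>) \<le> L * norm (x \<xi> - y \<xi>)" using \<xi> \<tau> by (intro lip) auto
      also have "\<dots> \<le> L * (m * exp (l * \<xi>))" using m[OF \<xi>] assms(2) by (intro mult_left_mono)
      finally show "norm (\<psi> \<xi> - \<phi> \<xi>) \<le> L * m * exp (l * \<xi>)" by (simp add: mult.assoc)
    next
      show "norm (\<psi> \<xi> - \<phi> \<xi>) \<le> B + B" for \<xi>
        using \<psi>(2)[of \<xi>] \<phi>(2)[of \<xi>] norm_triangle_ineq4[of "\<psi> \<xi>" "\<phi> \<xi>"] by linarith
    qed (use \<tau> assms(2) \<open>0 \<le> m\<close> \<psi>(1) \<phi>(1) in auto)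
    also have "L * m / l powr \<alpha> * exp (l * \<tau>) = L / l powr \<alpha> * (m * exp (l * \<tau>))" by simp
    also have "\<dots> \<le> 1 / 2 * (m * exp (l * \<tau>))" using l(2) \<open>0 \<le> m\<close> by (intro mult_right_mono) auto
    finally show "norm (x \<tau> - y \<tau>) \<le> 0 + m / 2 * exp (l * \<tau>)"
      using x[OF \<tau>] y[OF \<tau>] frac_int_diff[OF assms(1) \<psi> \<phi>] by simp
  qed (use l in auto)
  then show ?thesis by simp
qed

text \<open>
  With the weight \<open>exp (- l * \<tau>)\<close>, \<open>l\<close> large, the integral operator is a contraction on the whole interval.
\<close>

lemma frac_ode_exists_lipschitz:
  fixes g :: "real \<Rightarrow> 'a::euclidean_space \<Rightarrow> 'a"
  assumes \<alpha>: "0 < \<alpha>" "\<alpha> < 1" and "0 \<le> \<theta>"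
    and meas: "\<And>x. continuous_on UNIV x \<Longrightarrow> (\<lambda>\<xi>. g \<xi> (x \<xi>)) \<in> borel_measurable lebesgue"
    and bd: "\<And>\<xi> y. norm (g \<xi> y) \<le> M"
    and lip: "\<And>\<xi> y z. norm (g \<xi> y - g \<xi> z) \<le> L * norm (y - z)" and "0 \<le> L"
  obtains x where "continuous_on UNIV x"
    "\<And>\<tau>. \<tau> \<in> {0..\<theta>} \<Longrightarrow> x \<tau> = x0 + frac_int \<alpha> (\<lambda>\<xi>. g \<xi> (x \<xi>)) \<tau>"
proof -
  obtain l where l: "0 < l" "L / l powr \<alpha> \<le> 1 / 2" using exists_exp_weight[OF \<alpha>(1)] .
  \<comment> \<open>Clamping the time to \<open>[0, \<theta>]\<close> extends functions on that
    interval by constants to bounded continuous functions on the line, a complete space in which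
    Banach's theorem applies.\<close>
  define c where "c = (\<lambda>\<tau>::real. max 0 (min \<theta> \<tau>))"
  have c: "c \<tau> \<in> {0..\<theta>}" "\<tau> \<in> {0..\<theta>} \<Longrightarrow> c \<tau> = \<tau>" for \<tau> using assms(3) by (auto simp: c_def)
  \<comment> \<open>The weight is moved from the norm into the unknown: \<open>y\<close> stands for
    \<open>exp (- (l * \<xi>)) *\<^sub>R x \<xi>\<close>, so that the ordinary supremum distance of
    \<open>y\<close> is the weighted distance of \<open>x\<close>.\<close>
  define G where "G = (\<lambda>(y :: real \<Rightarrow>\<^sub>C 'a) \<xi>. g \<xi> (exp (l * \<xi>) *\<^sub>R y \<xi>))"
  have Gm: "G y \<in> borel_measurable lebesgue" for y
    unfolding G_def by (rule meas) (intro continuous_intros continuous_on_apply_bcontfun)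
  have Gb: "norm (G y \<xi>) \<le> M" for y \<xi> by (simp add: G_def bd)
  define F where "F = (\<lambda>y \<tau>. exp (- (l * \<tau>)) *\<^sub>R (x0 + frac_int \<alpha> (G y) \<tau>))"
  have Fc: "continuous_on {0..\<theta>} (F y)" for y
    unfolding F_def by (intro continuous_intros continuous_on_frac_int[OF \<alpha> Gm Gb])
  have Fb: "(\<lambda>\<tau>. F y (c \<tau>)) \<in> bcontfun" for y
    unfolding bcontfun_def
  proof (intro CollectI conjI)
    show "continuous_on UNIV (\<lambda>\<tau>. F y (c \<tau>))"
      by (rule continuous_on_compose2[OF Fc[of y]]) (use c(1) in \<open>auto simp: c_def intro!: continuous_intros\<close>)
    have "bounded (F y ` {0..\<theta>})" by (intro compact_imp_bounded compact_continuous_image Fc) simp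
    then show "bounded (range (\<lambda>\<tau>. F y (c \<tau>)))" by (rule bounded_subset) (use c(1) in auto)
  qed
  define \<Phi> where "\<Phi> = (\<lambda>y. Bcontfun (\<lambda>\<tau>. F y (c \<tau>)))"
  have \<Phi>: "apply_bcontfun (\<Phi> y) \<tau> = F y (c \<tau>)" for y \<tau>
    unfolding \<Phi>_def by (simp add: Bcontfun_inverse Fb)
  have "\<exists>!y. \<Phi> y = y"
  proof (rule banach_fix_type[of "1/2"]; (intro allI)?)
    fix y z
    show "dist (\<Phi> y) (\<Phi> z) \<le> 1 / 2 * dist y z"
    proof (rule dist_bound)
      fix \<tau>
      let ?s = "c \<tau>"
      have "norm (frac_int \<alpha> (\<lambda>\<xi>. G y \<xi> - G z \<xi>) ?s) \<le> L * dist y z / l powr \<alpha> * exp (l * ?s)"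
      proof (rule norm_frac_int_exp_le[OF \<alpha>(1) l(1)])
        fix \<xi>
        show "norm (G y \<xi> - G z \<xi>) \<le> M + M"
          using Gb[of y \<xi>] Gb[of z \<xi>] norm_triangle_ineq4[of "G y \<xi>" "G z \<xi>"] by linarith
        have "norm (G y \<xi> - G z \<xi>) \<le> L * norm (exp (l * \<xi>) *\<^sub>R y \<xi> - exp (l * \<xi>) *\<^sub>R z \<xi>)"
          unfolding G_def by (rule lip)
        also have "\<dots> = L * (exp (l * \<xi>) * dist (y \<xi>) (z \<xi>))"
          by (simp add: dist_norm flip: scaleR_diff_right)
        also have "\<dots> \<le> L * (exp (l * \<xi>) * dist y z)"
          using assms(7) by (intro mult_left_mono dist_bounded) auto
        finally show "norm (G y \<xi> - G z \<xi>) \<le> L * dist y z * exp (l * \<xi>)" by (simp add: mult_ac)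
      qed (use c(1)[of \<tau>] assms(7) Gm in auto)
      also have "L * dist y z / l powr \<alpha> * exp (l * ?s) = L / l powr \<alpha> * (dist y z * exp (l * ?s))" by simp
      also have "\<dots> \<le> 1 / 2 * (dist y z * exp (l * ?s))" using l(2) by (intro mult_right_mono) auto
      finally have *: "norm (frac_int \<alpha> (G y) ?s - frac_int \<alpha> (G z) ?s) \<le> 1 / 2 * dist y z * exp (l * ?s)"
        by (simp add: frac_int_diff[OF \<alpha>(1) Gm Gb Gm Gb])
      have "dist (\<Phi> y \<tau>) (\<Phi> z \<tau>) = exp (- (l * ?s)) * norm (frac_int \<alpha> (G y) ?s - frac_int \<alpha> (G z) ?s)"
        by (simp add: \<Phi> F_def dist_norm flip: scaleR_diff_right)
      also have "\<dots> \<le> exp (- (l * ?s)) * (1 / 2 * dist y z * exp (l * ?s))"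
        using * by (intro mult_left_mono) auto
      also have "\<dots> = 1 / 2 * dist y z" by (simp add: exp_minus field_simps)
      finally show "dist (\<Phi> y \<tau>) (\<Phi> z \<tau>) \<le> 1 / 2 * dist y z" .
    qed
  qed auto
  then obtain y where y: "\<Phi> y = y" by blast
  show thesis
  proof
    show "continuous_on UNIV (\<lambda>\<tau>. exp (l * \<tau>) *\<^sub>R y \<tau>)"
      by (intro continuous_intros continuous_on_apply_bcontfun)
    fix \<tau> assume \<tau>: "\<tau> \<in> {0..\<theta>}"
    have "exp (l * \<tau>) *\<^sub>R y \<tau> = exp (l * \<tau>) *\<^sub>R F y \<tau>"
      using \<Phi>[of y \<tau>] y c(2)[OF \<tau>] by simp
    also have "\<dots> = x0 + frac_int \<alpha> (G y) \<tau>" by (simp add: F_def flip: exp_add)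
    finally show "exp (l * \<tau>) *\<^sub>R y \<tau> = x0 + frac_int \<alpha> (\<lambda>\<xi>. g \<xi> (exp (l * \<xi>) *\<^sub>R y \<xi>)) \<tau>"
      by (simp add: G_def)
  qed
qed

text \<open>
  Projecting the state onto a ball that contains every solution makes the right-hand side globally Lipschitz
  without changing its solutions.
\<close>

lemma frac_ode_exists:
  fixes g :: "real \<Rightarrow> 'a::euclidean_space \<Rightarrow> 'a"
  assumes \<alpha>: "0 < \<alpha>" "\<alpha> < 1" and "0 \<le> \<theta>"
    and meas: "\<And>x. continuous_on UNIV x \<Longrightarrow> (\<lambda>\<xi>. g \<xi> (x \<xi>)) \<in> borel_measurable lebesgue"
    and growth: "\<And>\<xi> y. norm (g \<xi> y) \<le> C * (1 + norm y)" and "0 \<le> C"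
    and lip: "\<And>R. 0 < R \<Longrightarrow> \<exists>L\<ge>0. \<forall>\<xi> y z. norm y \<le> R \<longrightarrow> norm z \<le> R \<longrightarrow>
      norm (g \<xi> y - g \<xi> z) \<le> L * norm (y - z)"
  obtains x where "continuous_on UNIV x"
    "\<And>\<tau>. \<tau> \<in> {0..\<theta>} \<Longrightarrow> x \<tau> = x0 + frac_int \<alpha> (\<lambda>\<xi>. g \<xi> (x \<xi>)) \<tau>"
proof -
  obtain l where l: "0 < l" "C / l powr \<alpha> \<le> 1 / 2" using exists_exp_weight[OF \<alpha>(1)] .
  \<comment> \<open>This is the bound of \<open>frac_ode_bound\<close>. The projection
    \<open>p\<close> fixes 0 and does not increase distances, so
    \<open>norm (p y) \<le> norm y\<close> and the truncated equation satisfies the same growth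
    condition; its solution thus stays in the ball on which \<open>p\<close> is the
    identity.\<close>
  define R where "R = 2 * (1 + norm x0) * exp (l * \<theta>)"
  have R: "R > 0" unfolding R_def by (intro mult_pos_pos) (auto intro: add_pos_nonneg)
  obtain L where L: "0 \<le> L" "\<And>\<xi> y z. \<lbrakk>norm y \<le> R; norm z \<le> R\<rbrakk> \<Longrightarrow> norm (g \<xi> y - g \<xi> z) \<le> L * norm (y - z)"
    using lip[OF R] by blast
  define p where "p = closest_point (cball (0::'a) R)"
  have ball: "convex (cball (0::'a) R)" "closed (cball (0::'a) R)" "cball (0::'a) R \<noteq> {}" using R by auto
  have p_le: "norm (p y) \<le> R" for y
    using closest_point_in_set[OF ball(2,3), of y] by (simp add: p_def)
  have p_id: "p y = y" if "norm y \<le> R" for y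
    using that unfolding p_def by (intro closest_point_self) simp
  have p_lip: "norm (p y - p z) \<le> norm (y - z)" for y z
    using closest_point_lipschitz[OF ball, of y z] by (simp add: p_def dist_norm)
  have p_norm: "norm (p y) \<le> norm y" for y using p_lip[of y 0] p_id[of 0] R by simp
  have p_cont: "continuous_on UNIV p" unfolding p_def by (rule continuous_on_closest_point[OF ball])
  obtain x where x: "continuous_on UNIV x"
    "\<And>\<tau>. \<tau> \<in> {0..\<theta>} \<Longrightarrow> x \<tau> = x0 + frac_int \<alpha> (\<lambda>\<xi>. g \<xi> (p (x \<xi>))) \<tau>"
  proof (rule frac_ode_exists_lipschitz[OF \<alpha> assms(3), where g="\<lambda>\<xi> y. g \<xi> (p y)" and M="C * (1 + R)" and L=L and ?x0.0=x0])
    show "(\<lambda>\<xi>. g \<xi> (p (x \<xi>))) \<in> borel_measurable lebesgue" if "continuous_on UNIV x" for x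
      by (rule meas) (rule continuous_on_compose2[OF p_cont that], simp)
    show "norm (g \<xi> (p y)) \<le> C * (1 + R)" for \<xi> y
      using growth[of \<xi> "p y"] p_le[of y] assms(6) mult_left_mono[of "1 + norm (p y)" "1 + R" C] by linarith
    show "norm (g \<xi> (p y) - g \<xi> (p z)) \<le> L * norm (y - z)" for \<xi> y z
      using L(2)[OF p_le p_le, of \<xi> y z] mult_left_mono[OF p_lip[of y z] L(1)] by linarith
  qed (use L(1) in auto)
  have bound: "norm (x \<tau>) \<le> R" if "\<tau> \<in> {0..\<theta>}" for \<tau>
    unfolding R_def
  proof (rule frac_ode_bound[OF \<alpha>(1) l(1) assms(6) l(2) _ _ _ x(2) _ that])
    show "continuous_on {0..\<theta>} x" using x(1) by (rule continuous_on_subset) simp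
    show "(\<lambda>\<xi>. g \<xi> (p (x \<xi>))) \<in> borel_measurable lebesgue"
      by (rule meas) (rule continuous_on_compose2[OF p_cont x(1)], simp)
    show "norm (g \<xi> (p (x \<xi>))) \<le> C * (1 + R)" for \<xi>
      using growth[of \<xi> "p (x \<xi>)"] p_le[of "x \<xi>"] assms(6) mult_left_mono[of "1 + norm (p (x \<xi>))" "1 + R" C] by linarith
    show "norm (g \<xi> (p (x \<xi>))) \<le> C * (1 + norm (x \<xi>))" for \<xi>
      using growth[of \<xi> "p (x \<xi>)"] p_norm[of "x \<xi>"] assms(6) mult_left_mono[of "1 + norm (p (x \<xi>))" "1 + norm (x \<xi>)" C] by linarith
  qed
  show thesis
  proof (rule that[OF x(1)])
    fix \<tau> assume \<tau>: "\<tau> \<in> {0..\<theta>}"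
    have "frac_int \<alpha> (\<lambda>\<xi>. g \<xi> (p (x \<xi>))) \<tau> = frac_int \<alpha> (\<lambda>\<xi>. g \<xi> (x \<xi>)) \<tau>"
      using \<tau> bound by (intro frac_int_cong) (simp add: p_id)
    with x(2)[OF \<tau>] show "x \<tau> = x0 + frac_int \<alpha> (\<lambda>\<xi>. g \<xi> (x \<xi>)) \<tau>" by simp
  qed
qed

section \<open>Motions\<close>

text \<open>Continuity of \<open>h\<close> is known on a closed set only. A Tietze extension to the
  whole space is Borel and can be composed with the measurable triple of time, state and
  control.\<close>

lemma borel_measurable_along_control:
  fixes h :: "real \<Rightarrow> 'a::euclidean_space \<Rightarrow> 'b::euclidean_space \<Rightarrow> 'c::euclidean_space"
  assumes h: "continuous_on ({0..T} \<times> UNIV \<times> P) (\<lambda>(\<tau>, x, u). h \<tau> x u)" and "closed P"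
    and u: "u \<in> controls P t \<theta>" and "0 \<le> t" "\<theta> \<le> T" and x: "continuous_on {t..\<theta>} x"
  shows "(\<lambda>\<xi>. if \<xi> \<in> {t..\<theta>} then h \<xi> (x \<xi>) (u \<xi>) else 0) \<in> borel_measurable lebesgue"
proof (rule borel_measurable_if_I)
  have "closed ({0..T} \<times> (UNIV :: 'a set) \<times> P)" using assms(2) by (intro closed_Times) auto
  then obtain H where H: "continuous_on UNIV H"
    "\<And>z. z \<in> {0..T} \<times> UNIV \<times> P \<Longrightarrow> H z = (\<lambda>(\<tau>, x, u). h \<tau> x u) z"
    using Tietze_unbounded[OF h, of UNIV] by auto
  have Hm: "H \<in> borel_measurable borel" by (rule borel_measurable_continuous_onI[OF H(1)])
  have um: "u \<in> borel_measurable (lebesgue_on {t..\<theta>})" and uP: "\<And>\<xi>. \<xi> \<in> {t..\<theta>} \<Longrightarrow> u \<xi> \<in> P"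
    using u by (auto simp: controls_def)
  have xm: "x \<in> borel_measurable (lebesgue_on {t..\<theta>})"
    by (intro continuous_imp_measurable_on_sets_lebesgue x) simp
  have im: "(\<lambda>\<xi>. \<xi>) \<in> borel_measurable (lebesgue_on {t..\<theta>})"
    by (intro continuous_imp_measurable_on_sets_lebesgue continuous_on_id) simp
  have "(\<lambda>\<xi>. (\<xi>, x \<xi>, u \<xi>)) \<in> borel_measurable (lebesgue_on {t..\<theta>})"
    by (intro borel_measurable_Pair im xm um)
  then have "(\<lambda>\<xi>. H (\<xi>, x \<xi>, u \<xi>)) \<in> borel_measurable (lebesgue_on {t..\<theta>})"
    by (rule measurable_compose) (rule Hm)
  then show "(\<lambda>\<xi>. h \<xi> (x \<xi>) (u \<xi>)) \<in> borel_measurable (lebesgue_on {t..\<theta>})"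
    by (rule measurable_cong[THEN iffD1, rotated]) (use H(2) uP assms(4,5) in auto)
qed simp

lemma bounded_on_compact_states:
  fixes h :: "real \<Rightarrow> 'a::euclidean_space \<Rightarrow> 'b::euclidean_space \<Rightarrow> 'c::euclidean_space"
  assumes h: "continuous_on ({0..T} \<times> UNIV \<times> P) (\<lambda>(\<tau>, x, u). h \<tau> x u)" and "compact P"
  obtains B where "\<And>\<tau> x u. \<lbrakk>\<tau> \<in> {0..T}; norm x \<le> R; u \<in> P\<rbrakk> \<Longrightarrow> norm (h \<tau> x u) \<le> B"
proof -
  have "compact ((\<lambda>(\<tau>, x, u). h \<tau> x u) ` ({0..T} \<times> cball 0 R \<times> P))"
    using assms(2) by (intro compact_continuous_image continuous_on_subset[OF h] compact_Times) auto
  then have "bounded ((\<lambda>(\<tau>, x, u). h \<tau> x u) ` ({0..T} \<times> cball 0 R \<times> P))" by (rule compact_imp_bounded)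
  then obtain B where B: "\<forall>z \<in> (\<lambda>(\<tau>, x, u). h \<tau> x u) ` ({0..T} \<times> cball 0 R \<times> P). norm z \<le> B"
    unfolding bounded_iff by blast
  show thesis
  proof
    fix \<tau> and x :: 'a and u :: 'b
    assume "\<tau> \<in> {0..T}" "norm x \<le> R" "u \<in> P"
    then have "h \<tau> x u \<in> (\<lambda>(\<tau>, x, u). h \<tau> x u) ` ({0..T} \<times> cball 0 R \<times> P)"
      by (intro image_eqI[of _ _ "(\<tau>, x, u)"]) auto
    then show "norm (h \<tau> x u) \<le> B" using B by blast
  qed
qed

section \<open>Motions of the controlled system: existence, uniqueness and bounds\<close>

locale fractional_control_system =
  fixes T \<alpha> cf :: real and P :: "'b::euclidean_space set"
    and f :: "real \<Rightarrow> 'a::euclidean_space \<Rightarrow> 'b \<Rightarrow> 'a"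
  assumes alpha: "0 < \<alpha>" "\<alpha> < 1" and P: "P \<noteq> {}" "compact P"
    and f_cont: "continuous_on ({0..T} \<times> UNIV \<times> P) (\<lambda>(\<tau>, x, u). f \<tau> x u)"
    and f_lip: "\<And>R. R > 0 \<Longrightarrow> \<exists>L>0. \<forall>\<tau>\<in>{0..T}. \<forall>x x'. \<forall>u\<in>P.
      norm x \<le> R \<longrightarrow> norm x' \<le> R \<longrightarrow> norm (f \<tau> x u - f \<tau> x' u) \<le> L * norm (x - x')"
    and cf: "0 < cf"
    and f_growth: "\<And>\<tau> x u. \<lbrakk>\<tau> \<in> {0..T}; u \<in> P\<rbrakk> \<Longrightarrow> norm (f \<tau> x u) \<le> (1 + norm x) * cf"
begin

text \<open>The predicate under the description operator in \<open>motion\<close>, available before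
  its solution is known to be unique.\<close>

definition is_motion :: "real \<Rightarrow> (real \<Rightarrow> 'a) \<Rightarrow> real \<Rightarrow> (real \<Rightarrow> 'b) \<Rightarrow> (real \<Rightarrow> 'a) \<Rightarrow> bool" where
  "is_motion t w \<theta> u x \<longleftrightarrow> x \<in> AC_frac \<alpha> \<theta> \<and> (\<forall>\<tau>\<in>{0..t}. x \<tau> = w \<tau>) \<and>
     (AE \<tau> in lebesgue_on {t..\<theta>}. has_caputo_derivative \<alpha> \<theta> x (f \<tau> (x \<tau>) (u \<tau>)) \<tau>)"

lemma AE_is_motion:
  assumes "is_motion t w \<theta> u x"
  shows "AE \<tau> in lebesgue. \<tau> \<in> {t..\<theta>} \<longrightarrow> has_caputo_derivative \<alpha> \<theta> x (f \<tau> (x \<tau>) (u \<tau>)) \<tau>"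
  using assms by (simp add: is_motion_def AE_restrict_space_iff)

text \<open>
  A motion solves \<open>x = w 0 + frac_int \<alpha> (\<lambda>\<xi>. rhs t \<theta> \<phi> u \<xi> (x \<xi>))\<close> on the whole of \<open>[0, \<theta>]\<close>, where \<open>\<phi>\<close>
  is the Caputo derivative of the prescribed history \<open>w\<close>.
\<close>

definition rhs :: "real \<Rightarrow> real \<Rightarrow> (real \<Rightarrow> 'a) \<Rightarrow> (real \<Rightarrow> 'b) \<Rightarrow> real \<Rightarrow> 'a \<Rightarrow> 'a" where
  "rhs t \<theta> \<phi> u \<xi> y = (if \<xi> \<in> {0..<t} then \<phi> \<xi> else if \<xi> \<in> {t..\<theta>} then f \<xi> y (u \<xi>) else 0)"

lemma rhs_measurable:
  assumes "0 \<le> t" "\<theta> \<le> T" "u \<in> controls P t \<theta>" and \<phi>: "\<phi> \<in> borel_measurable borel"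
    and x: "continuous_on {0..\<theta>} x"
  shows "(\<lambda>\<xi>. rhs t \<theta> \<phi> u \<xi> (x \<xi>)) \<in> borel_measurable lebesgue"
proof -
  have "(\<lambda>\<xi>. if \<xi> \<in> {0..<t} then \<phi> \<xi> else 0) \<in> borel_measurable lebesgue"
    by (rule borel_imp_lebesgue_measurable) (use \<phi> in measurable)
  moreover have "(\<lambda>\<xi>. if \<xi> \<in> {t..\<theta>} then f \<xi> (x \<xi>) (u \<xi>) else 0) \<in> borel_measurable lebesgue"
    using assms(1,2,3) by (intro borel_measurable_along_control[OF f_cont compact_imp_closed[OF P(2)]]
      continuous_on_subset[OF x]) auto
  ultimately have "(\<lambda>\<xi>. (if \<xi> \<in> {0..<t} then \<phi> \<xi> else 0) + (if \<xi> \<in> {t..\<theta>} then f \<xi> (x \<xi>) (u \<xi>) else 0))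
      \<in> borel_measurable lebesgue"
    by (rule borel_measurable_add)
  moreover have "(if \<xi> \<in> {0..<t} then \<phi> \<xi> else 0) + (if \<xi> \<in> {t..\<theta>} then f \<xi> (x \<xi>) (u \<xi>) else 0)
      = rhs t \<theta> \<phi> u \<xi> (x \<xi>)" for \<xi>
    by (auto simp: rhs_def)
  ultimately show ?thesis by simp
qed

text \<open>\<open>C\<close> bounds the history and \<open>cf\<close> the growth of
  \<open>f\<close>; their sum serves both pieces and is the same for all controls.\<close>

lemma rhs_growth:
  assumes "0 \<le> t" "\<theta> \<le> T" "u \<in> controls P t \<theta>" and \<phi>: "\<And>\<xi>. norm (\<phi> \<xi>) \<le> C"
  shows "norm (rhs t \<theta> \<phi> u \<xi> y) \<le> (cf + C) * (1 + norm y)"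
proof -
  have C: "0 \<le> C" using \<phi>[of 0] norm_ge_zero order_trans by blast
  consider "\<xi> \<in> {0..<t}" | "\<xi> \<in> {t..\<theta>}" "\<xi> \<notin> {0..<t}" | "\<xi> \<notin> {0..<t}" "\<xi> \<notin> {t..\<theta>}" by blast
  then show ?thesis
  proof cases
    case 1
    have "norm (\<phi> \<xi>) \<le> (cf + C) * 1" using \<phi>[of \<xi>] cf by simp
    also have "\<dots> \<le> (cf + C) * (1 + norm y)" using cf C by (intro mult_left_mono) auto
    finally show ?thesis using 1 by (simp add: rhs_def)
  next
    case 2
    have "norm (f \<xi> y (u \<xi>)) \<le> (1 + norm y) * cf"
      using 2 assms by (intro f_growth) (auto simp: controls_def)
    also have "\<dots> \<le> (1 + norm y) * (cf + C)" using C by (intro mult_left_mono) auto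
    finally show ?thesis using 2 by (simp add: rhs_def mult.commute)
  next
    case 3
    then have "rhs t \<theta> \<phi> u \<xi> y = 0" by (simp only: rhs_def if_False)
    then show ?thesis using C cf by simp
  qed
qed

lemma rhs_lipschitz:
  assumes "0 \<le> t" "\<theta> \<le> T" "u \<in> controls P t \<theta>" "0 < R"
  shows "\<exists>L\<ge>0. \<forall>\<xi> y z. norm y \<le> R \<longrightarrow> norm z \<le> R \<longrightarrow>
    norm (rhs t \<theta> \<phi> u \<xi> y - rhs t \<theta> \<phi> u \<xi> z) \<le> L * norm (y - z)"
proof -
  obtain L where L: "L > 0" "\<And>\<tau> x x' u. \<lbrakk>\<tau> \<in> {0..T}; u \<in> P; norm x \<le> R; norm x' \<le> R\<rbrakk>
      \<Longrightarrow> norm (f \<tau> x u - f \<tau> x' u) \<le> L * norm (x - x')"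
    using f_lip[OF assms(4)] by blast
  show ?thesis
  proof (intro exI conjI allI impI)
    fix \<xi> y z assume yz: "norm (y :: 'a) \<le> R" "norm (z :: 'a) \<le> R"
    show "norm (rhs t \<theta> \<phi> u \<xi> y - rhs t \<theta> \<phi> u \<xi> z) \<le> L * norm (y - z)"
    proof (cases "\<xi> \<in> {t..\<theta>} \<and> \<xi> \<notin> {0..<t}")
      case True
      have "norm (f \<xi> y (u \<xi>) - f \<xi> z (u \<xi>)) \<le> L * norm (y - z)"
        using True assms yz by (intro L) (auto simp: controls_def)
      then show ?thesis using True by (simp add: rhs_def)
    next
      case False
      then have "rhs t \<theta> \<phi> u \<xi> y = rhs t \<theta> \<phi> u \<xi> z" by (auto simp: rhs_def)
      then show ?thesis using L(1) by simp
    qed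
  qed (use L(1) in simp)
qed

context
  fixes t \<theta> :: real and w :: "real \<Rightarrow> 'a" and u :: "real \<Rightarrow> 'b" and \<phi> :: "real \<Rightarrow> 'a" and C :: real
  assumes t: "0 \<le> t" "t \<le> \<theta>" "\<theta> \<le> T" and u: "u \<in> controls P t \<theta>"
    and \<phi>: "\<phi> \<in> borel_measurable borel" "\<And>\<xi>. norm (\<phi> \<xi>) \<le> C"
    and w: "\<And>\<tau>. \<tau> \<in> {0..t} \<Longrightarrow> w \<tau> = w 0 + frac_int \<alpha> \<phi> \<tau>"
begin

lemma rhs_bounded:
  assumes "continuous_on {0..\<theta>} x"
  shows "\<exists>B. \<forall>\<xi>. norm (rhs t \<theta> \<phi> u \<xi> (x \<xi>)) \<le> B"
proof -
  have "bounded (x ` {0..\<theta>})" by (intro compact_imp_bounded compact_continuous_image assms) simp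
  then obtain R where R: "\<And>\<xi>. \<xi> \<in> {0..\<theta>} \<Longrightarrow> norm (x \<xi>) \<le> R" unfolding bounded_iff by blast
  have C: "0 \<le> C" using \<phi>(2)[of 0] norm_ge_zero order_trans by blast
  have "norm (rhs t \<theta> \<phi> u \<xi> (x \<xi>)) \<le> (cf + C) * (1 + \<bar>R\<bar>)" for \<xi>
  proof (cases "\<xi> \<in> {0..\<theta>}")
    case True
    have "norm (rhs t \<theta> \<phi> u \<xi> (x \<xi>)) \<le> (cf + C) * (1 + norm (x \<xi>))"
      using t u \<phi> by (intro rhs_growth) auto
    also have "\<dots> \<le> (cf + C) * (1 + \<bar>R\<bar>)" using R[OF True] cf C by (intro mult_left_mono) auto
    finally show ?thesis .
  next
    case False
    then have "rhs t \<theta> \<phi> u \<xi> (x \<xi>) = 0" using t by (auto simp: rhs_def)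
    then show ?thesis using cf C by simp
  qed
  then show ?thesis by blast
qed

text \<open>Membership in \<open>AC_frac\<close> provides some density \<open>\<psi>\<close> of
  \<open>x\<close>. Almost everywhere it is the Caputo derivative, whose uniqueness identifies it
  with \<open>f\<close> after \<open>t\<close> and with \<open>\<phi>\<close> before
  \<open>t\<close>, where \<open>x\<close> coincides with \<open>w\<close>. The strict inequalities
  \<open>\<xi> < t\<close> and \<open>\<xi> < \<theta>\<close> guarantee the nondegenerate intervals
  on which the derivative is unique.\<close>

lemma is_motion_imp_integral_eq:
  assumes x: "is_motion t w \<theta> u x"
  shows "continuous_on {0..\<theta>} x"
    "\<And>\<tau>. \<tau> \<in> {0..\<theta>} \<Longrightarrow> x \<tau> = w 0 + frac_int \<alpha> (\<lambda>\<xi>. rhs t \<theta> \<phi> u \<xi> (x \<xi>)) \<tau>"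
proof -
  have xw: "\<And>\<tau>. \<tau> \<in> {0..t} \<Longrightarrow> x \<tau> = w \<tau>" using x by (auto simp: is_motion_def)
  have "0 \<le> \<theta>" using t by simp
  have "x \<in> AC_frac \<alpha> \<theta>" using x by (simp add: is_motion_def)
  then obtain \<psi> B where \<psi>: "\<psi> \<in> borel_measurable borel" "\<And>\<xi>. norm (\<psi> \<xi>) \<le> B"
    and x\<psi>: "\<And>\<tau>. \<tau> \<in> {0..\<theta>} \<Longrightarrow> x \<tau> = x 0 + frac_int \<alpha> \<psi> \<tau>"
    by (rule AC_frac_E[OF _ \<open>0 \<le> \<theta>\<close>]) (rule that)
  have \<psi>m: "\<psi> \<in> borel_measurable lebesgue" using \<psi>(1) by (rule borel_imp_lebesgue_measurable)
  have \<phi>m: "\<phi> \<in> borel_measurable lebesgue" using \<phi>(1) by (rule borel_imp_lebesgue_measurable)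
  have "continuous_on {0..\<theta>} (\<lambda>\<tau>. x 0 + frac_int \<alpha> \<psi> \<tau>)"
    by (intro continuous_intros continuous_on_frac_int[OF alpha \<psi>m \<psi>(2)])
  then show cont: "continuous_on {0..\<theta>} x"
    by (rule continuous_on_eq) (rule x\<psi>[symmetric])
  have "AE \<xi> in lebesgue. \<xi> \<in> {0..\<theta>} \<longrightarrow> has_caputo_derivative \<alpha> \<theta> x (\<psi> \<xi>) \<xi>"
    by (rule has_caputo_derivative_frac_int_AE[OF alpha \<psi>m \<psi>(2) x\<psi>])
  moreover have "AE \<xi> in lebesgue. \<xi> \<in> {0..t} \<longrightarrow> has_caputo_derivative \<alpha> t w (\<phi> \<xi>) \<xi>"
    by (rule has_caputo_derivative_frac_int_AE[OF alpha \<phi>m \<phi>(2) w])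
  ultimately have eq: "AE \<xi> in lebesgue. 0 \<le> \<xi> \<longrightarrow> \<xi> < \<theta> \<longrightarrow> \<psi> \<xi> = rhs t \<theta> \<phi> u \<xi> (x \<xi>)"
    using AE_is_motion[OF x]
  proof eventually_elim
    case (elim \<xi>)
    show ?case
    proof (intro impI)
      assume \<xi>: "0 \<le> \<xi>" "\<xi> < \<theta>"
      then have c: "has_caputo_derivative \<alpha> \<theta> x (\<psi> \<xi>) \<xi>" using elim by auto
      show "\<psi> \<xi> = rhs t \<theta> \<phi> u \<xi> (x \<xi>)"
      proof (cases "\<xi> < t")
        case True
        have "has_caputo_derivative \<alpha> t w (\<psi> \<xi>) \<xi>"
          using has_caputo_derivative_restrict[OF c, of t w] True \<xi> t xw by simp
        moreover have "has_caputo_derivative \<alpha> t w (\<phi> \<xi>) \<xi>" using elim True \<xi> by auto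
        ultimately have "\<psi> \<xi> = \<phi> \<xi>" by (rule has_caputo_derivative_unique) (use True \<xi> in auto)
        then show ?thesis using True \<xi> by (simp add: rhs_def)
      next
        case False
        then have "has_caputo_derivative \<alpha> \<theta> x (f \<xi> (x \<xi>) (u \<xi>)) \<xi>" using elim \<xi> by auto
        with c have "\<psi> \<xi> = f \<xi> (x \<xi>) (u \<xi>)" by (rule has_caputo_derivative_unique) (use \<xi> in auto)
        then show ?thesis using False \<xi> by (simp add: rhs_def)
      qed
    qed
  qed
  fix \<tau> assume \<tau>: "\<tau> \<in> {0..\<theta>}"
  have "frac_int \<alpha> \<psi> \<tau> = frac_int \<alpha> (\<lambda>\<xi>. rhs t \<theta> \<phi> u \<xi> (x \<xi>)) \<tau>"
  proof (rule frac_int_cong_AE[OF _ \<psi>m])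
    show "AE \<xi> in lebesgue. 0 \<le> \<xi> \<longrightarrow> \<xi> < \<tau> \<longrightarrow> \<psi> \<xi> = rhs t \<theta> \<phi> u \<xi> (x \<xi>)"
      using eq by eventually_elim (use \<tau> in auto)
    show "(\<lambda>\<xi>. rhs t \<theta> \<phi> u \<xi> (x \<xi>)) \<in> borel_measurable lebesgue"
      by (rule rhs_measurable[OF t(1,3) u \<phi>(1) cont])
  qed
  moreover have "x 0 = w 0" using xw t by simp
  ultimately show "x \<tau> = w 0 + frac_int \<alpha> (\<lambda>\<xi>. rhs t \<theta> \<phi> u \<xi> (x \<xi>)) \<tau>"
    using x\<psi>[OF \<tau>] by (simp only:)
qed

lemma integral_eq_imp_is_motion:
  assumes ext: "x \<in> extensional {0..\<theta>}" and cont: "continuous_on {0..\<theta>} x"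
    and x: "\<And>\<tau>. \<tau> \<in> {0..\<theta>} \<Longrightarrow> x \<tau> = w 0 + frac_int \<alpha> (\<lambda>\<xi>. rhs t \<theta> \<phi> u \<xi> (x \<xi>)) \<tau>"
  shows "is_motion t w \<theta> u x"
proof -
  obtain B where B: "\<And>\<xi>. norm (rhs t \<theta> \<phi> u \<xi> (x \<xi>)) \<le> B" using rhs_bounded[OF cont] by blast
  note m = rhs_measurable[OF t(1,3) u \<phi>(1) cont]
  have "x 0 = w 0" using x[of 0] t by (simp add: frac_int_at_0)
  then have x': "x \<tau> = x 0 + frac_int \<alpha> (\<lambda>\<xi>. rhs t \<theta> \<phi> u \<xi> (x \<xi>)) \<tau>" if "\<tau> \<in> {0..\<theta>}" for \<tau>
    using x[OF that] by (simp only:)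
  have "x \<in> AC_frac \<alpha> \<theta>" by (rule AC_frac_I[OF ext m B x'])
  moreover have "x \<tau> = w \<tau>" if "\<tau> \<in> {0..t}" for \<tau>
  proof -
    have "frac_int \<alpha> (\<lambda>\<xi>. rhs t \<theta> \<phi> u \<xi> (x \<xi>)) \<tau> = frac_int \<alpha> \<phi> \<tau>"
      using that by (intro frac_int_cong) (auto simp: rhs_def)
    then show ?thesis using x[of \<tau>] w[OF that] that t by simp
  qed
  moreover have "AE \<xi> in lebesgue. \<xi> \<in> {0..\<theta>} \<longrightarrow> has_caputo_derivative \<alpha> \<theta> x (rhs t \<theta> \<phi> u \<xi> (x \<xi>)) \<xi>"
    by (rule has_caputo_derivative_frac_int_AE[OF alpha m B x'])
  then have "AE \<xi> in lebesgue. \<xi> \<in> {t..\<theta>} \<longrightarrow> has_caputo_derivative \<alpha> \<theta> x (f \<xi> (x \<xi>) (u \<xi>)) \<xi>"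
    by eventually_elim (use t in \<open>auto simp: rhs_def\<close>)
  ultimately show ?thesis by (simp add: is_motion_def AE_restrict_space_iff)
qed

lemma ex1_is_motion_aux: "\<exists>!x. is_motion t w \<theta> u x"
proof (rule ex_ex1I)
  have "0 \<le> \<theta>" using t by simp
  have C: "0 \<le> C" using \<phi>(2)[of 0] norm_ge_zero order_trans by blast
  obtain x where x: "continuous_on UNIV x"
    "\<And>\<tau>. \<tau> \<in> {0..\<theta>} \<Longrightarrow> x \<tau> = w 0 + frac_int \<alpha> (\<lambda>\<xi>. rhs t \<theta> \<phi> u \<xi> (x \<xi>)) \<tau>"
  proof (rule frac_ode_exists[OF alpha \<open>0 \<le> \<theta>\<close>, where g="rhs t \<theta> \<phi> u" and C="cf + C" and ?x0.0="w 0"])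
    show "(\<lambda>\<xi>. rhs t \<theta> \<phi> u \<xi> (x \<xi>)) \<in> borel_measurable lebesgue" if "continuous_on UNIV x" for x
      by (rule rhs_measurable[OF t(1,3) u \<phi>(1) continuous_on_subset[OF that]]) simp
    show "norm (rhs t \<theta> \<phi> u \<xi> y) \<le> (cf + C) * (1 + norm y)" for \<xi> y
      by (rule rhs_growth[OF t(1,3) u \<phi>(2)])
    show "\<exists>L\<ge>0. \<forall>\<xi> y z. norm y \<le> R \<longrightarrow> norm z \<le> R \<longrightarrow>
      norm (rhs t \<theta> \<phi> u \<xi> y - rhs t \<theta> \<phi> u \<xi> z) \<le> L * norm (y - z)" if "0 < R" for R
      by (rule rhs_lipschitz[OF t(1,3) u that])
  qed (use cf C in auto)
  have "is_motion t w \<theta> u (restrict x {0..\<theta>})"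
  proof (rule integral_eq_imp_is_motion)
    show "continuous_on {0..\<theta>} (restrict x {0..\<theta>})"
      by (rule continuous_on_cong[THEN iffD1, OF refl _ continuous_on_subset[OF x(1)]]) auto
    fix \<tau> assume \<tau>: "\<tau> \<in> {0..\<theta>}"
    have "frac_int \<alpha> (\<lambda>\<xi>. rhs t \<theta> \<phi> u \<xi> (restrict x {0..\<theta>} \<xi>)) \<tau> = frac_int \<alpha> (\<lambda>\<xi>. rhs t \<theta> \<phi> u \<xi> (x \<xi>)) \<tau>"
      using \<tau> by (intro frac_int_cong) auto
    then show "restrict x {0..\<theta>} \<tau> = w 0 + frac_int \<alpha> (\<lambda>\<xi>. rhs t \<theta> \<phi> u \<xi> (restrict x {0..\<theta>} \<xi>)) \<tau>"
      using x(2)[OF \<tau>] \<tau> by simp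
  qed simp
  then show "\<exists>x. is_motion t w \<theta> u x" by (rule exI[of "is_motion t w \<theta> u"])
next
  fix x y assume xy: "is_motion t w \<theta> u x" "is_motion t w \<theta> u y"
  note x = is_motion_imp_integral_eq[OF xy(1)]
  note y = is_motion_imp_integral_eq[OF xy(2)]
  obtain Bx where Bx: "\<And>\<xi>. norm (rhs t \<theta> \<phi> u \<xi> (x \<xi>)) \<le> Bx" using rhs_bounded[OF x(1)] by blast
  obtain By where By: "\<And>\<xi>. norm (rhs t \<theta> \<phi> u \<xi> (y \<xi>)) \<le> By" using rhs_bounded[OF y(1)] by blast
  \<comment> \<open>A common ball for both motions yields a single Lipschitz constant.\<close>
  have "bounded (x ` {0..\<theta>} \<union> y ` {0..\<theta>})"
    by (intro bounded_Un[THEN iffD2] conjI compact_imp_bounded compact_continuous_image x y) auto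
  then obtain R where R: "0 < R" "\<And>z. z \<in> x ` {0..\<theta>} \<union> y ` {0..\<theta>} \<Longrightarrow> norm z \<le> R"
    unfolding bounded_pos by blast
  obtain L where L: "0 \<le> L" "\<And>\<xi> y z. \<lbrakk>norm y \<le> R; norm z \<le> R\<rbrakk> \<Longrightarrow>
      norm (rhs t \<theta> \<phi> u \<xi> y - rhs t \<theta> \<phi> u \<xi> z) \<le> L * norm (y - z)"
    using rhs_lipschitz[OF t(1,3) u R(1)] by blast
  have "x \<tau> = y \<tau>" if "\<tau> \<in> {0..\<theta>}" for \<tau>
  proof (rule frac_ode_unique[OF alpha(1) L(1) x(1) y(1) _ _ _ _ x(2) y(2) _ that, where B="max Bx By"])
    show "(\<lambda>\<xi>. rhs t \<theta> \<phi> u \<xi> (x \<xi>)) \<in> borel_measurable lebesgue"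
      by (rule rhs_measurable[OF t(1,3) u \<phi>(1) x(1)])
    show "(\<lambda>\<xi>. rhs t \<theta> \<phi> u \<xi> (y \<xi>)) \<in> borel_measurable lebesgue"
      by (rule rhs_measurable[OF t(1,3) u \<phi>(1) y(1)])
    show "norm (rhs t \<theta> \<phi> u \<xi> (x \<xi>) - rhs t \<theta> \<phi> u \<xi> (y \<xi>)) \<le> L * norm (x \<xi> - y \<xi>)" if "0 \<le> \<xi>" "\<xi> < \<theta>" for \<xi>
      using that by (intro L(2) R(2)) auto
  qed (use Bx By in \<open>auto simp: le_max_iff_disj\<close>)
  moreover have "x \<in> extensional {0..\<theta>}" "y \<in> extensional {0..\<theta>}"
    using xy by (auto simp: is_motion_def AC_frac_def)
  ultimately show "x = y" by (intro extensionalityI)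
qed

end

lemma ex1_is_motion:
  assumes "0 \<le> t" "t \<le> \<theta>" "\<theta> \<le> T" "w \<in> AC_frac \<alpha> t" "u \<in> controls P t \<theta>"
  shows "\<exists>!x. is_motion t w \<theta> u x"
  using assms(4) by (rule AC_frac_E[OF _ assms(1)]) (rule ex1_is_motion_aux[OF assms(1-3,5)])

lemma is_motion_motion:
  assumes "0 \<le> t" "t \<le> \<theta>" "\<theta> \<le> T" "w \<in> AC_frac \<alpha> t" "u \<in> controls P t \<theta>"
  shows "is_motion t w \<theta> u (motion \<alpha> f t w \<theta> u)"
  using theI'[OF ex1_is_motion[OF assms]] by (simp add: motion_def is_motion_def)

lemma motion_eqI:
  assumes "0 \<le> t" "t \<le> \<theta>" "\<theta> \<le> T" "w \<in> AC_frac \<alpha> t" "u \<in> controls P t \<theta>" "is_motion t w \<theta> u x"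
  shows "motion \<alpha> f t w \<theta> u = x"
  using ex1_is_motion[OF assms(1-5)] is_motion_motion[OF assms(1-5)] assms(6) by blast

lemma continuous_on_motion:
  assumes "0 \<le> t" "t \<le> \<theta>" "\<theta> \<le> T" "w \<in> AC_frac \<alpha> t" "u \<in> controls P t \<theta>"
  shows "continuous_on {0..\<theta>} (motion \<alpha> f t w \<theta> u)"
  using assms(4)
  by (rule AC_frac_E[OF _ assms(1)]) (rule is_motion_imp_integral_eq(1)[OF assms(1-3,5) _ _ _ is_motion_motion[OF assms]])

text \<open>The growth constant \<open>cf + C\<close>, and with it the weight \<open>l\<close>, is
  fixed before the control is chosen, so the a priori bound is uniform over all controls.\<close>

lemma motion_bounded:
  assumes "0 \<le> t" "t \<le> \<theta>" "\<theta> \<le> T" "w \<in> AC_frac \<alpha> t"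
  obtains R where "\<And>u \<tau>. \<lbrakk>u \<in> controls P t \<theta>; \<tau> \<in> {0..\<theta>}\<rbrakk> \<Longrightarrow> norm (motion \<alpha> f t w \<theta> u \<tau>) \<le> R"
proof -
  obtain \<phi> C where \<phi>: "\<phi> \<in> borel_measurable borel" "\<And>\<xi>. norm (\<phi> \<xi>) \<le> C"
    and w: "\<And>\<tau>. \<tau> \<in> {0..t} \<Longrightarrow> w \<tau> = w 0 + frac_int \<alpha> \<phi> \<tau>"
    using assms(4) by (rule AC_frac_E[OF _ assms(1)]) (rule that)
  have C: "0 \<le> C" using \<phi>(2)[of 0] norm_ge_zero order_trans by blast
  obtain l where l: "0 < l" "(cf + C) / l powr \<alpha> \<le> 1 / 2" using exists_exp_weight[OF alpha(1)] .
  show thesis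
  proof (rule that)
    fix u \<tau> assume u: "u \<in> controls P t \<theta>" and \<tau>: "\<tau> \<in> {0..\<theta>}"
    note x = is_motion_imp_integral_eq[OF assms(1-3) u \<phi> w is_motion_motion[OF assms u]]
    obtain B where B: "\<And>\<xi>. norm (rhs t \<theta> \<phi> u \<xi> (motion \<alpha> f t w \<theta> u \<xi>)) \<le> B"
      using rhs_bounded[OF assms(1-3) u \<phi> w x(1)] by blast
    show "norm (motion \<alpha> f t w \<theta> u \<tau>) \<le> 2 * (1 + norm (w 0)) * exp (l * \<theta>)"
      by (rule frac_ode_bound[OF alpha(1) l(1) _ l(2) x(1) rhs_measurable[OF assms(1,3) u \<phi>(1) x(1)] B x(2) _ \<tau>])
        (use C cf rhs_growth[OF assms(1,3) u \<phi>(2)] in auto)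
  qed
qed

end

section \<open>Dynamic programming\<close>

lemma controls_restrict:
  assumes "u \<in> controls P a b" "{c..d} \<subseteq> {a..b}"
  shows "restrict u {c..d} \<in> controls P c d"
proof -
  have "u \<in> borel_measurable (lebesgue_on {c..d})"
    by (rule measurable_restrict_mono[of u lebesgue "{a..b}"]) (use assms in \<open>auto simp: controls_def\<close>)
  then have "restrict u {c..d} \<in> borel_measurable (lebesgue_on {c..d})"
    by (rule measurable_cong[THEN iffD1, rotated]) auto
  then show ?thesis using assms by (auto simp: controls_def)
qed

text \<open>Both controls are defined at \<open>b\<close>; the first one prevails and the value of
  \<open>v\<close> there is lost. For this reason \<open>v\<close> enters through the half-open
  interval, and later comparisons with the second piece hold on \<open>{b<..c}\<close> only.\<close>

lemma controls_concat:
  assumes u: "u \<in> controls P a b" and v: "v \<in> controls P b c" and "a \<le> b" "b \<le> c"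
  shows "(\<lambda>\<xi>. if \<xi> \<le> b then u \<xi> else v \<xi>) \<in> controls P a c"
proof -
  have "v \<in> borel_measurable (lebesgue_on {b<..c})"
    by (rule measurable_restrict_mono[of v lebesgue "{b..c}"]) (use v in \<open>auto simp: controls_def\<close>)
  then have 1: "(\<lambda>\<xi>. if \<xi> \<in> {b<..c} then v \<xi> else 0) \<in> borel_measurable lebesgue"
    by (rule borel_measurable_if_I) simp
  have "u \<in> borel_measurable (lebesgue_on {a..b})" using u by (auto simp: controls_def)
  then have "(\<lambda>\<xi>. if \<xi> \<in> {a..b} then u \<xi> else 0) \<in> borel_measurable lebesgue"
    by (rule borel_measurable_if_I) simp
  from borel_measurable_add[OF this 1]
  have "(\<lambda>\<xi>. (if \<xi> \<in> {a..b} then u \<xi> else 0) + (if \<xi> \<in> {b<..c} then v \<xi> else 0))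
      \<in> borel_measurable (lebesgue_on {a..c})"
    by (rule measurable_restrict_space1)
  then have "(\<lambda>\<xi>. if \<xi> \<le> b then u \<xi> else v \<xi>) \<in> borel_measurable (lebesgue_on {a..c})"
    by (rule measurable_cong[THEN iffD1, rotated]) auto
  then show ?thesis using u v assms(3,4) by (auto simp: controls_def PiE_iff extensional_def)
qed

lemma controls_nonempty:
  assumes "P \<noteq> {}"
  shows "controls P a b \<noteq> {}"
proof -
  obtain p where "p \<in> P" using assms by blast
  moreover have "(\<lambda>_\<in>{a..b}. p) \<in> borel_measurable (lebesgue_on {a..b})"
    by (rule measurable_cong[THEN iffD1, OF _ measurable_const]) auto
  ultimately have "(\<lambda>_\<in>{a..b}. p) \<in> controls P a b" by (auto simp: controls_def)
  then show ?thesis by blast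
qed

lemma AC_frac_restrict:
  fixes x :: "real \<Rightarrow> 'a::euclidean_space"
  assumes "x \<in> AC_frac \<alpha> \<theta>" "0 \<le> t" "t \<le> \<theta>"
  shows "restrict x {0..t} \<in> AC_frac \<alpha> t"
proof -
  have "0 \<le> \<theta>" using assms by simp
  with assms(1) obtain \<psi> C where \<psi>: "\<psi> \<in> borel_measurable borel" "\<And>\<xi>. norm (\<psi> \<xi>) \<le> C"
    and x: "\<And>\<tau>. \<tau> \<in> {0..\<theta>} \<Longrightarrow> x \<tau> = x 0 + frac_int \<alpha> \<psi> \<tau>"
    by (rule AC_frac_E) (rule that)
  show ?thesis
  proof (rule AC_frac_I[OF _ borel_imp_lebesgue_measurable[OF \<psi>(1)] \<psi>(2)])
    fix \<tau> assume "\<tau> \<in> {0..t}"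
    then show "restrict x {0..t} \<tau> = restrict x {0..t} 0 + frac_int \<alpha> \<psi> \<tau>"
      using x[of \<tau>] assms by simp
  qed simp
qed

context fractional_control_system
begin

lemma is_motion_restrict:
  assumes x: "is_motion t w T u x" and "0 \<le> t" "t \<le> \<theta>" "\<theta> \<le> T"
    and v: "\<And>\<xi>. \<xi> \<in> {t..\<theta>} \<Longrightarrow> v \<xi> = u \<xi>"
  shows "is_motion t w \<theta> v (restrict x {0..\<theta>})"
proof -
  have "restrict x {0..\<theta>} \<in> AC_frac \<alpha> \<theta>"
    using x assms by (intro AC_frac_restrict[of x \<alpha> T]) (auto simp: is_motion_def)
  moreover have "\<forall>\<tau>\<in>{0..t}. restrict x {0..\<theta>} \<tau> = w \<tau>"
    using x assms by (auto simp: is_motion_def)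
  moreover have "AE \<tau> in lebesgue. \<tau> \<in> {t..\<theta>} \<longrightarrow>
      has_caputo_derivative \<alpha> \<theta> (restrict x {0..\<theta>}) (f \<tau> (restrict x {0..\<theta>} \<tau>) (v \<tau>)) \<tau>"
    using AE_is_motion[OF x]
  proof eventually_elim
    case (elim \<tau>)
    show ?case
    proof
      assume \<tau>: "\<tau> \<in> {t..\<theta>}"
      then have "has_caputo_derivative \<alpha> T x (f \<tau> (x \<tau>) (u \<tau>)) \<tau>" using elim assms by auto
      then have "has_caputo_derivative \<alpha> \<theta> (restrict x {0..\<theta>}) (f \<tau> (x \<tau>) (u \<tau>)) \<tau>"
        by (rule has_caputo_derivative_restrict) (use \<tau> assms in auto)
      then show "has_caputo_derivative \<alpha> \<theta> (restrict x {0..\<theta>}) (f \<tau> (restrict x {0..\<theta>} \<tau>) (v \<tau>)) \<tau>"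
        using \<tau> v[OF \<tau>] assms(2) by simp
    qed
  qed
  ultimately show ?thesis by (simp add: is_motion_def AE_restrict_space_iff)
qed

text \<open>The equation is required almost everywhere, so the controls may differ at the single
  point \<open>\<theta>\<close>, as happens after a concatenation.\<close>

lemma is_motion_continue:
  assumes x: "is_motion t w T u x" and "0 \<le> t" "t \<le> \<theta>" "\<theta> \<le> T"
    and v: "\<And>\<xi>. \<xi> \<in> {\<theta><..T} \<Longrightarrow> v \<xi> = u \<xi>"
  shows "is_motion \<theta> (restrict x {0..\<theta>}) T v x"
proof -
  have "{\<theta>} \<in> null_sets lebesgue" by (simp add: negligible_iff_null_sets[symmetric])
  then have "AE \<tau> in lebesgue. \<tau> \<notin> {\<theta>}" by (rule AE_not_in)
  then have "AE \<tau> in lebesgue. \<tau> \<in> {\<theta>..T} \<longrightarrow> has_caputo_derivative \<alpha> T x (f \<tau> (x \<tau>) (v \<tau>)) \<tau>"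
    using AE_is_motion[OF x] by eventually_elim (use v assms in auto)
  then show ?thesis using x by (simp add: is_motion_def AE_restrict_space_iff)
qed

end

section \<open>Splitting the cost and taking infima\<close>

locale fractional_optimal_control = fractional_control_system T \<alpha> cf P f
  for T \<alpha> cf :: real and P :: "'b::euclidean_space set"
    and f :: "real \<Rightarrow> 'a::euclidean_space \<Rightarrow> 'b \<Rightarrow> 'a" +
  fixes \<sigma> :: "'a \<Rightarrow> real" and chi :: "real \<Rightarrow> 'a \<Rightarrow> 'b \<Rightarrow> real"
  assumes \<sigma>_cont: "continuous_on UNIV \<sigma>"
    and chi_cont: "continuous_on ({0..T} \<times> UNIV \<times> P) (\<lambda>(\<tau>, x, u). chi \<tau> x u)"
begin

lemma absolutely_integrable_running_cost:
  assumes "0 \<le> a" "b \<le> T" "u \<in> controls P a b" and x: "continuous_on {a..b} x"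
  shows "(\<lambda>\<xi>. chi \<xi> (x \<xi>) (u \<xi>)) absolutely_integrable_on {a..b}"
proof -
  have "(\<lambda>\<xi>. if \<xi> \<in> {a..b} then chi \<xi> (x \<xi>) (u \<xi>) else 0) \<in> borel_measurable lebesgue"
    by (rule borel_measurable_along_control[OF chi_cont compact_imp_closed[OF P(2)] assms(3,1,2) x])
  then have m: "(\<lambda>\<xi>. chi \<xi> (x \<xi>) (u \<xi>)) \<in> borel_measurable (lebesgue_on {a..b})"
    by (rule borel_measurable_if_D)
  have "bounded (x ` {a..b})" by (intro compact_imp_bounded compact_continuous_image x) simp
  then obtain R where R: "\<And>\<xi>. \<xi> \<in> {a..b} \<Longrightarrow> norm (x \<xi>) \<le> R" unfolding bounded_iff by blast
  obtain B where B: "\<And>\<tau> x u. \<lbrakk>\<tau> \<in> {0..T}; norm x \<le> R; u \<in> P\<rbrakk> \<Longrightarrow> norm (chi \<tau> x u) \<le> B"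
    by (rule bounded_on_compact_states[OF chi_cont P(2), of R]) (rule that)
  show ?thesis
  proof (rule measurable_bounded_by_integrable_imp_absolutely_integrable[OF m])
    show "norm (chi \<xi> (x \<xi>) (u \<xi>)) \<le> B" if "\<xi> \<in> {a..b}" for \<xi>
      using that assms by (intro B R) (auto simp: controls_def)
  qed auto
qed

text \<open>The three controls are related by agreement instead of by an explicit construction, so
  that one statement covers both directions of the principle: \<open>u\<close> may be glued from
  \<open>u1\<close> and \<open>u2\<close>, or these may be restrictions of \<open>u\<close>.\<close>

lemma cost_split:
  assumes "0 \<le> t" "t \<le> \<theta>" "\<theta> \<le> T" and w: "w \<in> AC_frac \<alpha> t"
    and u: "u \<in> controls P t T" and u1: "u1 \<in> controls P t \<theta>" and u2: "u2 \<in> controls P \<theta> T"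
    and eq1: "\<And>\<xi>. \<xi> \<in> {t..\<theta>} \<Longrightarrow> u1 \<xi> = u \<xi>" and eq2: "\<And>\<xi>. \<xi> \<in> {\<theta><..T} \<Longrightarrow> u2 \<xi> = u \<xi>"
  defines "y \<equiv> motion \<alpha> f t w \<theta> u1"
  shows "y \<in> AC_frac \<alpha> \<theta>"
    and "cost \<alpha> T f \<sigma> chi t w u =
      cost \<alpha> T f \<sigma> chi \<theta> y u2 + (LINT \<tau>:{t..\<theta>}|lebesgue. chi \<tau> (y \<tau>) (u1 \<tau>))"
proof -
  have tT: "t \<le> T" using assms by simp
  define x where "x = motion \<alpha> f t w T u"
  have x: "is_motion t w T u x"
    unfolding x_def by (rule is_motion_motion[OF assms(1) tT order_refl w u])
  have y: "y = restrict x {0..\<theta>}"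
    unfolding y_def
    by (rule motion_eqI[OF assms(1-3) w u1 is_motion_restrict[OF x assms(1-3) eq1]])
  show yAC: "y \<in> AC_frac \<alpha> \<theta>"
    using is_motion_motion[OF assms(1-3) w u1] by (simp add: y_def is_motion_def)
  have \<theta>0: "0 \<le> \<theta>" using assms by simp
  have x': "motion \<alpha> f \<theta> y T u2 = x"
    by (rule motion_eqI[OF \<theta>0 assms(3) order_refl yAC u2])
      (use is_motion_continue[OF x assms(1-3) eq2] y in simp)
  have xc: "continuous_on {0..T} x"
    unfolding x_def by (rule continuous_on_motion[OF assms(1) tT order_refl w u])
  have i: "(\<lambda>\<xi>. chi \<xi> (x \<xi>) (u \<xi>)) absolutely_integrable_on {t..T}"
    by (rule absolutely_integrable_running_cost[OF assms(1) order_refl u continuous_on_subset[OF xc]])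
      (use assms in auto)
  have i2: "(\<lambda>\<xi>. chi \<xi> (x \<xi>) (u2 \<xi>)) absolutely_integrable_on {\<theta>..T}"
    by (rule absolutely_integrable_running_cost[OF \<theta>0 order_refl u2 continuous_on_subset[OF xc]])
      (use \<theta>0 in auto)
  have i1: "(\<lambda>\<xi>. chi \<xi> (x \<xi>) (u \<xi>)) absolutely_integrable_on {t..\<theta>}"
    using assms by (intro absolutely_integrable_on_subinterval[OF i]) auto
  have "(LINT \<tau>:{t..T}|lebesgue. chi \<tau> (x \<tau>) (u \<tau>)) = integral {t..T} (\<lambda>\<tau>. chi \<tau> (x \<tau>) (u \<tau>))"
    by (rule set_lebesgue_integral_eq_integral(2)[OF i])
  also have "\<dots> = integral {t..\<theta>} (\<lambda>\<tau>. chi \<tau> (x \<tau>) (u \<tau>)) + integral {\<theta>..T} (\<lambda>\<tau>. chi \<tau> (x \<tau>) (u \<tau>))"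
    by (rule Henstock_Kurzweil_Integration.integral_combine[symmetric, OF assms(2,3) set_lebesgue_integral_eq_integral(1)[OF i]])
  also have "integral {t..\<theta>} (\<lambda>\<tau>. chi \<tau> (x \<tau>) (u \<tau>)) = (LINT \<tau>:{t..\<theta>}|lebesgue. chi \<tau> (x \<tau>) (u \<tau>))"
    by (rule set_lebesgue_integral_eq_integral(2)[OF i1, symmetric])
  also have "\<dots> = (LINT \<tau>:{t..\<theta>}|lebesgue. chi \<tau> (y \<tau>) (u1 \<tau>))"
    using assms(1) eq1 by (intro set_lebesgue_integral_cong) (auto simp: y)
  also have "integral {\<theta>..T} (\<lambda>\<tau>. chi \<tau> (x \<tau>) (u \<tau>)) = integral {\<theta>..T} (\<lambda>\<tau>. chi \<tau> (x \<tau>) (u2 \<tau>))"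
    by (rule integral_spike[of "{\<theta>}"]) (use eq2 in auto)
  also have "\<dots> = (LINT \<tau>:{\<theta>..T}|lebesgue. chi \<tau> (x \<tau>) (u2 \<tau>))"
    by (rule set_lebesgue_integral_eq_integral(2)[OF i2, symmetric])
  finally show "cost \<alpha> T f \<sigma> chi t w u =
      cost \<alpha> T f \<sigma> chi \<theta> y u2 + (LINT \<tau>:{t..\<theta>}|lebesgue. chi \<tau> (y \<tau>) (u1 \<tau>))"
    by (simp add: cost_def Let_def x' flip: x_def)
qed

text \<open>All motions from the given position stay in one ball, on which compactness bounds
  \<open>\<sigma>\<close> and, together with compactness of \<open>P\<close>, also
  \<open>chi\<close>.\<close>

lemma bdd_below_cost:
  assumes "0 \<le> t" "t \<le> T" "w \<in> AC_frac \<alpha> t"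
  shows "bdd_below (cost \<alpha> T f \<sigma> chi t w ` controls P t T)"
proof -
  obtain R where R: "\<And>u \<tau>. \<lbrakk>u \<in> controls P t T; \<tau> \<in> {0..T}\<rbrakk> \<Longrightarrow> norm (motion \<alpha> f t w T u \<tau>) \<le> R"
    by (rule motion_bounded[OF assms(1,2) order_refl assms(3)]) (rule that)
  obtain B where B: "\<And>\<tau> x u. \<lbrakk>\<tau> \<in> {0..T}; norm x \<le> R; u \<in> P\<rbrakk> \<Longrightarrow> norm (chi \<tau> x u) \<le> B"
    by (rule bounded_on_compact_states[OF chi_cont P(2), of R]) (rule that)
  have "bounded (\<sigma> ` cball 0 R)"
    by (intro compact_imp_bounded compact_continuous_image continuous_on_subset[OF \<sigma>_cont]) auto
  then obtain S where S: "\<And>x. norm x \<le> R \<Longrightarrow> \<bar>\<sigma> x\<bar> \<le> S" unfolding bounded_real by force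
  show ?thesis
  proof (rule bdd_belowI2)
    fix u assume u: "u \<in> controls P t T"
    define x where "x = motion \<alpha> f t w T u"
    have xR: "norm (x \<tau>) \<le> R" if "\<tau> \<in> {0..T}" for \<tau> unfolding x_def by (rule R[OF u that])
    have i: "(\<lambda>\<xi>. chi \<xi> (x \<xi>) (u \<xi>)) absolutely_integrable_on {t..T}"
      by (rule absolutely_integrable_running_cost[OF assms(1) order_refl u
            continuous_on_subset[OF continuous_on_motion[OF assms(1,2) order_refl assms(3) u, folded x_def]]])
        (use assms in auto)
    have "norm (integral {t..T} (\<lambda>\<xi>. chi \<xi> (x \<xi>) (u \<xi>))) \<le> integral {t..T} (\<lambda>_. B)"
    proof (rule Henstock_Kurzweil_Integration.integral_norm_bound_integral)
      show "(\<lambda>\<xi>. chi \<xi> (x \<xi>) (u \<xi>)) integrable_on {t..T}"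
        by (rule set_lebesgue_integral_eq_integral(1)[OF i])
      show "norm (chi \<xi> (x \<xi>) (u \<xi>)) \<le> B" if "\<xi> \<in> {t..T}" for \<xi>
        using that assms u by (intro B xR) (auto simp: controls_def)
    qed auto
    also have "\<dots> = B * (T - t)" using assms by simp
    finally have "- (B * (T - t)) \<le> (LINT \<tau>:{t..T}|lebesgue. chi \<tau> (x \<tau>) (u \<tau>))"
      by (simp add: set_lebesgue_integral_eq_integral(2)[OF i] abs_le_iff)
    moreover have "- S \<le> \<sigma> (x T)" using S[OF xR[of T]] assms by (simp add: abs_le_iff)
    ultimately show "- S - B * (T - t) \<le> cost \<alpha> T f \<sigma> chi t w u"
      by (simp add: cost_def Let_def flip: x_def)
  qed
qed

lemma dynamic_programming_principle:
  assumes "0 \<le> t" "t \<le> \<theta>" "\<theta> \<le> T" and w: "w \<in> AC_frac \<alpha> t"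
  shows "value_functional \<alpha> T P f \<sigma> chi t w =
    (INF u\<in>controls P t \<theta>.
       value_functional \<alpha> T P f \<sigma> chi \<theta> (motion \<alpha> f t w \<theta> u) +
       (LINT \<tau>:{t..\<theta>}|lebesgue. chi \<tau> (motion \<alpha> f t w \<theta> u \<tau>) (u \<tau>)))"
    (is "_ = (INF u\<in>_. ?V u)")
proof (rule antisym)
  have \<theta>0: "0 \<le> \<theta>" and tT: "t \<le> T" using assms by auto
  have le: "value_functional \<alpha> T P f \<sigma> chi t w \<le> ?V u" if u: "u \<in> controls P t \<theta>" for u
  proof -
    let ?y = "motion \<alpha> f t w \<theta> u" and ?I = "LINT \<tau>:{t..\<theta>}|lebesgue. chi \<tau> (motion \<alpha> f t w \<theta> u \<tau>) (u \<tau>)"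
    \<comment> \<open>The running cost \<open>?I\<close> up to \<open>\<theta>\<close> does not
      depend on the second control; moved to the left side, it leaves an infimum over
      \<open>v\<close> alone.\<close>
    have "value_functional \<alpha> T P f \<sigma> chi t w - ?I \<le> value_functional \<alpha> T P f \<sigma> chi \<theta> ?y"
      unfolding value_functional_def[of _ _ _ _ _ _ \<theta>]
    proof (rule cINF_greatest[OF controls_nonempty[OF P(1)]])
      fix v assume v: "v \<in> controls P \<theta> T"
      let ?u = "\<lambda>\<xi>. if \<xi> \<le> \<theta> then u \<xi> else v \<xi>"
      have uv: "?u \<in> controls P t T" by (rule controls_concat[OF u v assms(2,3)])
      have "value_functional \<alpha> T P f \<sigma> chi t w \<le> cost \<alpha> T f \<sigma> chi t w ?u"
        unfolding value_functional_def by (rule cINF_lower[OF bdd_below_cost[OF assms(1) tT w] uv])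
      also have "\<dots> = cost \<alpha> T f \<sigma> chi \<theta> ?y v + ?I"
        by (rule cost_split(2)[OF assms(1-3) w uv u v]) auto
      finally show "value_functional \<alpha> T P f \<sigma> chi t w - ?I \<le> cost \<alpha> T f \<sigma> chi \<theta> ?y v" by simp
    qed
    then show ?thesis by simp
  qed
  then show "value_functional \<alpha> T P f \<sigma> chi t w \<le> (INF u\<in>controls P t \<theta>. ?V u)"
    by (intro cINF_greatest controls_nonempty P)
  \<comment> \<open>The inequality just proved for each \<open>u\<close> doubles as the lower bound
    that makes the outer infimum meaningful.\<close>
  have bdd: "bdd_below (?V ` controls P t \<theta>)" using le by (rule bdd_belowI2)
  show "(INF u\<in>controls P t \<theta>. ?V u) \<le> value_functional \<alpha> T P f \<sigma> chi t w"
    unfolding value_functional_def[of _ _ _ _ _ _ t]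
  proof (rule cINF_greatest[OF controls_nonempty[OF P(1)]])
    fix u assume u: "u \<in> controls P t T"
    let ?u1 = "restrict u {t..\<theta>}" and ?u2 = "restrict u {\<theta>..T}"
    have u1: "?u1 \<in> controls P t \<theta>" using assms by (intro controls_restrict[OF u]) auto
    have u2: "?u2 \<in> controls P \<theta> T" using assms by (intro controls_restrict[OF u]) auto
    have split: "motion \<alpha> f t w \<theta> ?u1 \<in> AC_frac \<alpha> \<theta>"
      "cost \<alpha> T f \<sigma> chi t w u = cost \<alpha> T f \<sigma> chi \<theta> (motion \<alpha> f t w \<theta> ?u1) ?u2 +
        (LINT \<tau>:{t..\<theta>}|lebesgue. chi \<tau> (motion \<alpha> f t w \<theta> ?u1 \<tau>) (?u1 \<tau>))"
      by (rule cost_split[OF assms(1-3) w u u1 u2]; simp)+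
    have "(INF u\<in>controls P t \<theta>. ?V u) \<le> ?V ?u1" by (rule cINF_lower[OF bdd u1])
    \<comment> \<open>The restriction to \<open>[\<theta>, T]\<close> competes in the inner infimum;
      \<open>split(1)\<close> certifies that the state reached is a position, so that the costs from
      it are bounded below.\<close>
    also have "\<dots> \<le> cost \<alpha> T f \<sigma> chi t w u"
      unfolding split(2) value_functional_def
      by (intro add_right_mono cINF_lower[OF bdd_below_cost[OF \<theta>0 assms(3) split(1)] u2])
    finally show "(INF u\<in>controls P t \<theta>. ?V u) \<le> cost \<alpha> T f \<sigma> chi t w u" .
  qed
qed

end

theorem theorem6p1:
  fixes T \<alpha> :: real
    and P :: "(real ^ 'm) set"
    and f :: "real \<Rightarrow> real ^ 'n \<Rightarrow> real ^ 'm \<Rightarrow> real ^ 'n"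
    and \<sigma> :: "real ^ 'n \<Rightarrow> real"
    and chi :: "real \<Rightarrow> real ^ 'n \<Rightarrow> real ^ 'm \<Rightarrow> real"
    and t \<theta> :: real
    and w :: "real \<Rightarrow> real ^ 'n"
  assumes "T > 0"
    and "0 < \<alpha>" and "\<alpha> < 1"
    and "P \<noteq> {}" and "compact P"
    and "continuous_on ({0..T} \<times> UNIV \<times> P) (\<lambda>(\<tau>, x, u). f \<tau> x u)"
    and "\<And>R. R > 0 \<Longrightarrow> \<exists>L>0. \<forall>\<tau>\<in>{0..T}. \<forall>x x'. \<forall>u\<in>P.
           norm x \<le> R \<longrightarrow> norm x' \<le> R \<longrightarrow>
           norm (f \<tau> x u - f \<tau> x' u) \<le> L * norm (x - x')"
    and "\<exists>cf>0. \<forall>\<tau>\<in>{0..T}. \<forall>x. \<forall>u\<in>P. norm (f \<tau> x u) \<le> (1 + norm x) * cf"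
    and "continuous_on UNIV \<sigma>"
    and "continuous_on ({0..T} \<times> UNIV \<times> P) (\<lambda>(\<tau>, x, u). chi \<tau> x u)"
    and "(t, w) \<in> positions \<alpha> T"
    and "\<theta> \<in> {t..T}"
  shows "value_functional \<alpha> T P f \<sigma> chi t w =
    (INF u\<in>controls P t \<theta>.
       let x = motion \<alpha> f t w \<theta> u
       in value_functional \<alpha> T P f \<sigma> chi \<theta> x + (LINT \<tau>:{t..\<theta>}|lebesgue. chi \<tau> (x \<tau>) (u \<tau>)))"
proof -
  obtain cf where cf: "cf > 0" "\<And>\<tau> x u. \<lbrakk>\<tau> \<in> {0..T}; u \<in> P\<rbrakk> \<Longrightarrow> norm (f \<tau> x u) \<le> (1 + norm x) * cf"
    using assms(8) by blast
  interpret fractional_optimal_control T \<alpha> cf P f \<sigma> chi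
    using assms(2-7,9,10) cf by unfold_locales
  have "0 \<le> t" "t \<le> \<theta>" "\<theta> \<le> T" "w \<in> AC_frac \<alpha> t"
    using assms(11,12) by (auto simp: positions_def)
  then show ?thesis unfolding Let_def by (rule dynamic_programming_principle)
qed

end
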